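(* Suppose the set of processes under consideration (the calculus) satisfies the weak aliased communication property. Then the function $$F=(\mathcal F_{\gtrsim}\cup\mathrm{id}\cup\mathtt{refl}\cup\mathtt{sub}\cup\mathtt{res}\cup\mathtt{pcomp}\cup\mathtt{sum_g}\cup\mathtt{rep}\cup\mathtt{tau}\cup\mathtt{out}\cup\mathtt{inp})^\omega$$ is $\overline{wb}$-sound: there exists an extensive function $f'$ such that for every relation $\mathcal R$, $\mathcal R\subseteq\overline{wb}(F(\mathcal R))$ implies $f'(\mathcal R)\subseteq\overline{wb}(f'(\mathcal R))$.
   Context: $\pi$-calculus processes: $P ::= !G \mid P|P \mid (\nu a)P \mid G$, $G ::= \mathbf 0 \mid \bar a\langle b\rangle.P \mid a(b).P \mid \tau.P \mid G+G$, up to $\alpha$-conversion; $P\sigma$ is capture-avoiding application of a name substitution. Visible actions $\alpha ::= \bar a\langle b\rangle \mid \bar a(b) \mid ab$ (output, bound output, early input); $\mu::=\alpha\mid\tau$. Early LTS: $a(b).P\xrightarrow{ac}P\{c/b\}$; $\bar a\langle b\rangle.P\xrightarrow{\bar a\langle b\rangle}P$; $\tau.P\xrightarrow\tau P$; if $!G|G\xrightarrow{\mu}P'$ then $!G\xrightarrow{\mu}P'$; if $P\xrightarrow{\bar a\langle b\rangle}P'$, $b\ne a$ then $(\nu b)P\xrightarrow{\bar a(b)}P'$; if $G\xrightarrow\mu P'$ then $G+G'\xrightarrow\mu P'$ and $G'+G\xrightarrow\mu P'$; if $P\xrightarrow\mu P'$, $a\notin\mathrm n(\mu)$ then $(\nu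 a)P\xrightarrow\mu(\nu a)P'$; if $P\xrightarrow\mu P'$, $\mathrm{bn}(\mu)\cap\mathrm{fn}(Q)=\emptyset$ then $P|Q\xrightarrow\mu P'|Q$; if $P\xrightarrow{ab}P'$, $Q\xrightarrow{\bar a\langle b\rangle}Q'$ then $P|Q\xrightarrow\tau P'|Q'$; if $P\xrightarrow{ab}P'$, $Q\xrightarrow{\bar a(b)}Q'$, $b\notin\mathrm{fn}(P)$ then $P|Q\xrightarrow\tau(\nu b)(P'|Q')$; plus symmetric versions. Weak arrows: $\Rightarrow$ is $(\xrightarrow\tau)^*$; $\xRightarrow{\alpha}$ is $\Rightarrow\xrightarrow\alpha\Rightarrow$; $\hat\Rightarrow^{\alpha}=\xRightarrow\alpha$ and $\hat\Rightarrow^{\tau}=\Rightarrow$. Also $\hat\to^{\alpha}=\xrightarrow\alpha$ and $\hat\to^{\tau}$ is zero or one $\tau$-step. Weak aliased communication property: for every process $P$ considered, (i) if $P\xRightarrow{\bar a\langle b\rangle}\xRightarrow{cb}P'$ then $P\sigma\Rightarrow P'\sigma$ for every substitution $\sigma$ with $a\sigma=c\sigma$; (ii) if $P\xRightarrow{\bar a(b)}\xRightarrow{cb}P'$ then $P\sigma\Rightarrow(\nu b)P'\sigma$ for every such $\sigma$. $ws(\mathcal R)=\{(P,Q)\mid$ for all $\mu,P'$, $P\xrightarrow\mu P'$ implies $\exists Q'$, $Q\hat\Rightarrow^{\mu}Q'$, $P'\mathcal RQ'\}$; $wb(\mathcal R)=\{(P,Q)\mid (P,Q)\in ws(\mathcal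 R),(Q,P)\in ws(\mathcal R^{-1})\}$; $\overline{wb}(\mathcal R)=\mathcal R\cap wb(\mathcal R)$. $s'(\mathcal R)=\{(P,Q)\mid$ for all $\mu,P'$, $P\xrightarrow\mu P'$ implies $\exists Q'$, $Q\hat\to^{\mu}Q'$, $P'\mathcal RQ'\}$; the expansion preorder $\gtrsim$ is the largest relation $\mathcal R$ such that every $(P,Q)\in\mathcal R$ satisfies $(P,Q)\in ws(\mathcal R)$ and $(Q,P)\in s'(\mathcal R^{-1})$; $\lesssim$ is its inverse. Up-to functions: $\mathcal F_{\gtrsim}(\mathcal R)={\gtrsim}\mathcal R{\lesssim}$ (relational composition); $\mathtt{refl}(\mathcal R)=\{(P,P)\}$; $\mathtt{sub}(\mathcal R)=\{(P\sigma,Q\sigma)\mid P\mathcal RQ\}$; $\mathtt{res}(\mathcal R)=\{((\nu\tilde a)P,(\nu\tilde a)Q)\mid P\mathcal RQ\}$; $\mathtt{pcomp}(\mathcal R)=\{(P|P',Q|Q')\mid P\mathcal RQ,P'\mathcal RQ'\}$; $\mathtt{rep}(\mathcal R)=\{(!G,!G')\mid G\mathcal RG'\}$; $\mathtt{tau}(\mathcal R)=\{(\tau.P,\tau.Q)\mid P\mathcal RQ\}$; $\mathtt{out}(\mathcal R)=\{(\bar a\langle b\rangle.P,\bar a\langle b\rangle.Q)\mid P\mathcal RQ\}$; $\mathtt{inp}(\mathcal R)=\{(a(b).P,a(b).Q)\mid P\mathcal RQ\}$; $\mathtt{sum_g}(\mathcal R)=\{(\sum_iG_i,\sum_iG_i')\mid\forall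 i,(G_i,G_i')\in(\mathtt{tau}\cup\mathtt{out}\cup\mathtt{inp}\cup\mathtt{refl})(\mathcal R)\}$. Unions are pointwise, $f^0=\mathrm{id}$, $f^{n+1}=f\circ f^n$, $f^\omega(\mathcal R)=\bigcup_nf^n(\mathcal R)$; extensive means $\mathcal R\subseteq f'(\mathcal R)$ for all $\mathcal R$.
   Formalization: Expansion is reversed from the printed definition (P ≳ Q: Q answers each τ of P by at most one τ), since as printed {(τ.a, 0)} refutes the claim; relations and F are taken within the calculus, which is closed under transitions, and bound output names are fresh for both processes. *)

theory Defs
  imports Main
begin

section \<open>Processes up to alpha-conversion\<close>

text \<open>
  Names are natural numbers. An element of \<^typ>\<open>nat\<close> in a process is a de Bruijn index: under
  \<open>k\<close> binders, the indices below \<open>k\<close> are bound and index \<open>k + n\<close> is the free name \<open>n\<close>. Hence every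
  element of the datatype \<open>proc\<close> below is exactly one alpha-equivalence class of processes, and
  equality on \<open>proc\<close> is alpha-equivalence. The constructors \<open>Nu\<close> and \<open>Inp\<close> are the nameless
  binders; everything after the definition of the named binders \<open>nu b P\<close> and \<open>inp a b P\<close> is
  phrased with the latter. The lemmas below state that these behave as binders of the name \<open>b\<close>.
\<close>

type_synonym name = nat

datatype proc = Bang gproc | Par proc proc | Nu proc | Grd gproc
  and gproc = Zero | Out name name proc | Inp name proc | Tau proc | Sum gproc gproc

definition lift :: "(name \<Rightarrow> name) \<Rightarrow> name \<Rightarrow> name" where
  "lift \<sigma> = case_nat 0 (\<lambda>n. Suc (\<sigma> n))"

primrec subst :: "(name \<Rightarrow> name) \<Rightarrow> proc \<Rightarrow> proc"
  and gsubst :: "(name \<Rightarrow> name) \<Rightarrow> gproc \<Rightarrow> gproc" where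
  "subst \<sigma> (Bang G) = Bang (gsubst \<sigma> G)"
| "subst \<sigma> (Par P Q) = Par (subst \<sigma> P) (subst \<sigma> Q)"
| "subst \<sigma> (Nu P) = Nu (subst (lift \<sigma>) P)"
| "subst \<sigma> (Grd G) = Grd (gsubst \<sigma> G)"
| "gsubst \<sigma> Zero = Zero"
| "gsubst \<sigma> (Out a b P) = Out (\<sigma> a) (\<sigma> b) (subst \<sigma> P)"
| "gsubst \<sigma> (Inp a P) = Inp (\<sigma> a) (subst (lift \<sigma>) P)"
| "gsubst \<sigma> (Tau P) = Tau (subst \<sigma> P)"
| "gsubst \<sigma> (Sum G H) = Sum (gsubst \<sigma> G) (gsubst \<sigma> H)"

primrec fn :: "proc \<Rightarrow> name set" and gfn :: "gproc \<Rightarrow> name set" where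
  "fn (Bang G) = gfn G"
| "fn (Par P Q) = fn P \<union> fn Q"
| "fn (Nu P) = {n. Suc n \<in> fn P}"
| "fn (Grd G) = gfn G"
| "gfn Zero = {}"
| "gfn (Out a b P) = {a, b} \<union> fn P"
| "gfn (Inp a P) = {a} \<union> {n. Suc n \<in> fn P}"
| "gfn (Tau P) = fn P"
| "gfn (Sum G H) = gfn G \<union> gfn H"

definition bind :: "name \<Rightarrow> name \<Rightarrow> name" where
  "bind b = (\<lambda>n. if n = b then 0 else Suc n)"

definition nu :: "name \<Rightarrow> proc \<Rightarrow> proc" where
  "nu b P = Nu (subst (bind b) P)"

definition inp :: "name \<Rightarrow> name \<Rightarrow> proc \<Rightarrow> gproc" where
  "inp a b P = Inp a (subst (bind b) P)"

definition nus :: "name list \<Rightarrow> proc \<Rightarrow> proc" where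
  "nus as P = foldr nu as P"

definition fresh_for :: "name \<Rightarrow> (name \<Rightarrow> name) \<Rightarrow> bool" where
  "fresh_for b \<sigma> \<longleftrightarrow> \<sigma> b = b \<and> (\<forall>x. x \<noteq> b \<longrightarrow> \<sigma> x \<noteq> b)"

lemma lift_id [simp]: "lift id = id"
  by (auto simp: lift_def fun_eq_iff split: nat.split)

lemma lift_comp: "lift \<rho> \<circ> lift \<sigma> = lift (\<rho> \<circ> \<sigma>)"
  by (auto simp: lift_def fun_eq_iff split: nat.split)

lemma subst_id [simp]: "subst id P = P" "gsubst id G = G"
  by (induction P and G) (simp_all add: lift_id[unfolded id_def] id_def)

lemma subst_subst:
  "subst \<rho> (subst \<sigma> P) = subst (\<rho> \<circ> \<sigma>) P"
  "gsubst \<rho> (gsubst \<sigma> G) = gsubst (\<rho> \<circ> \<sigma>) G"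
  by (induction P and G arbitrary: \<rho> \<sigma> and \<rho> \<sigma>) (auto simp: lift_comp)

lemma subst_cong_fn:
  "(\<forall>x \<in> fn P. \<rho> x = \<sigma> x) \<Longrightarrow> subst \<rho> P = subst \<sigma> P"
  "(\<forall>x \<in> gfn G. \<rho> x = \<sigma> x) \<Longrightarrow> gsubst \<rho> G = gsubst \<sigma> G"
proof (induction P and G arbitrary: \<rho> \<sigma> and \<rho> \<sigma>)
  case (Nu P)
  have "subst (lift \<rho>) P = subst (lift \<sigma>) P"
    by (rule Nu.IH) (use Nu.prems in \<open>auto simp: lift_def split: nat.split\<close>)
  then show ?case by simp
next
  case (Inp a P)
  have "subst (lift \<rho>) P = subst (lift \<sigma>) P"
    by (rule Inp.IH) (use Inp.prems in \<open>auto simp: lift_def split: nat.split\<close>)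
  then show ?case using Inp.prems by simp
next
  case (Par P Q)
  show ?case using Par.prems Par.IH[of \<rho> \<sigma>] by simp
next
  case (Sum G H)
  show ?case using Sum.prems Sum.IH[of \<rho> \<sigma>] by simp
next
  case (Out a b P)
  show ?case using Out.prems Out.IH[of \<rho> \<sigma>] by simp
next
  case (Tau P)
  show ?case using Tau.prems Tau.IH[of \<rho> \<sigma>] by simp
next
  case (Bang G)
  show ?case using Bang.prems Bang.IH[of \<rho> \<sigma>] by simp
next
  case (Grd G)
  show ?case using Grd.prems Grd.IH[of \<rho> \<sigma>] by simp
qed simp

lemma image_lift: "{n. Suc n \<in> lift \<sigma> ` A} = \<sigma> ` {n. Suc n \<in> A}"
proof -
  have "Suc n = lift \<sigma> x \<longleftrightarrow> (\<exists>m. x = Suc m \<and> n = \<sigma> m)" for n x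
    by (cases x) (simp_all add: lift_def)
  then show ?thesis by (simp add: image_iff set_eq_iff) blast
qed

lemma fn_subst: "fn (subst \<sigma> P) = \<sigma> ` fn P" "gfn (gsubst \<sigma> G) = \<sigma> ` gfn G"
  by (induction P and G arbitrary: \<sigma> and \<sigma>) (simp_all add: image_Un image_lift)

lemma subst_inj:
  "inj \<sigma> \<Longrightarrow> subst \<sigma> P = subst \<sigma> Q \<Longrightarrow> P = Q"
proof -
  assume "inj \<sigma>" "subst \<sigma> P = subst \<sigma> Q"
  then have "subst (inv \<sigma>) (subst \<sigma> P) = subst (inv \<sigma>) (subst \<sigma> Q)" by simp
  with \<open>inj \<sigma>\<close> show "P = Q" by (simp add: subst_subst)
qed

lemma inj_bind: "inj (bind b)"
  by (rule injI) (simp add: bind_def split: if_splits)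

lemma fn_nu: "fn (nu b P) = fn P - {b}"
  by (auto simp: nu_def fn_subst bind_def split: if_splits)

lemma gfn_inp: "gfn (inp a b P) = {a} \<union> (fn P - {b})"
  by (auto simp: inp_def fn_subst bind_def split: if_splits)

lemma nu_alpha: "c \<notin> fn P \<Longrightarrow> nu b P = nu c (subst (id(b := c)) P)"
  unfolding nu_def by (auto simp: subst_subst bind_def intro!: subst_cong_fn)

lemma inp_alpha: "c \<notin> fn P \<Longrightarrow> inp a b P = inp a c (subst (id(b := c)) P)"
  unfolding inp_def by (auto simp: subst_subst bind_def intro!: subst_cong_fn)

lemma nu_inject: "nu b P = nu b Q \<Longrightarrow> P = Q"
  unfolding nu_def by (simp add: subst_inj[OF inj_bind])

lemma inp_inject: "inp a b P = inp a' b Q \<Longrightarrow> a = a' \<and> P = Q"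
  unfolding inp_def by (auto dest: subst_inj[OF inj_bind])

lemma subst_nu: "fresh_for b \<sigma> \<Longrightarrow> subst \<sigma> (nu b P) = nu b (subst \<sigma> P)"
  unfolding nu_def fresh_for_def
  by (auto simp: subst_subst bind_def lift_def intro!: subst_cong_fn)

lemma subst_inp: "fresh_for b \<sigma> \<Longrightarrow> gsubst \<sigma> (inp a b P) = inp (\<sigma> a) b (subst \<sigma> P)"
  unfolding inp_def fresh_for_def
  by (auto simp: subst_subst bind_def lift_def intro!: subst_cong_fn)

lemma nu_exhaust:
  assumes "b \<notin> fn (Nu P)"
  shows "\<exists>Q. Nu P = nu b Q"
proof
  have "subst (bind b \<circ> case_nat b id) P = subst id P"
    by (rule subst_cong_fn) (use assms in \<open>auto simp: bind_def split: nat.split\<close>)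
  then show "Nu P = nu b (subst (case_nat b id) P)"
    by (simp add: nu_def subst_subst)
qed

lemma inp_exhaust:
  assumes "b \<notin> fn (Nu P)"
  shows "\<exists>Q. Inp a P = inp a b Q"
  using nu_exhaust[OF assms] by (auto simp: nu_def inp_def)


section \<open>Early labelled transition system\<close>

datatype act = OutA name name | BOutA name name | InA name name | TauA

primrec names :: "act \<Rightarrow> name set" where
  "names (OutA a b) = {a, b}"
| "names (BOutA a b) = {a, b}"
| "names (InA a b) = {a, b}"
| "names TauA = {}"

primrec bn :: "act \<Rightarrow> name set" where
  "bn (OutA a b) = {}"
| "bn (BOutA a b) = {b}"
| "bn (InA a b) = {}"
| "bn TauA = {}"

inductive step :: "proc \<Rightarrow> act \<Rightarrow> proc \<Rightarrow> bool" where
  inp: "step (Grd (inp a b P)) (InA a c) (subst (id(b := c)) P)"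
| out: "step (Grd (Out a b P)) (OutA a b) P"
| tau: "step (Grd (Tau P)) TauA P"
| rep: "step (Par (Bang G) (Grd G)) \<mu> P' \<Longrightarrow> step (Bang G) \<mu> P'"
| "open": "step P (OutA a b) P' \<Longrightarrow> b \<noteq> a \<Longrightarrow> step (nu b P) (BOutA a b) P'"
| sumL: "step (Grd G) \<mu> P' \<Longrightarrow> step (Grd (Sum G G')) \<mu> P'"
| sumR: "step (Grd G) \<mu> P' \<Longrightarrow> step (Grd (Sum G' G)) \<mu> P'"
| res: "step P \<mu> P' \<Longrightarrow> a \<notin> names \<mu> \<Longrightarrow> step (nu a P) \<mu> (nu a P')"
| parL: "step P \<mu> P' \<Longrightarrow> bn \<mu> \<inter> fn Q = {} \<Longrightarrow> step (Par P Q) \<mu> (Par P' Q)"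
| parR: "step P \<mu> P' \<Longrightarrow> bn \<mu> \<inter> fn Q = {} \<Longrightarrow> step (Par Q P) \<mu> (Par Q P')"
| commL: "step P (InA a b) P' \<Longrightarrow> step Q (OutA a b) Q' \<Longrightarrow> step (Par P Q) TauA (Par P' Q')"
| commR: "step P (InA a b) P' \<Longrightarrow> step Q (OutA a b) Q' \<Longrightarrow> step (Par Q P) TauA (Par Q' P')"
| closeL: "step P (InA a b) P' \<Longrightarrow> step Q (BOutA a b) Q' \<Longrightarrow> b \<notin> fn P \<Longrightarrow>
    step (Par P Q) TauA (nu b (Par P' Q'))"
| closeR: "step P (InA a b) P' \<Longrightarrow> step Q (BOutA a b) Q' \<Longrightarrow> b \<notin> fn P \<Longrightarrow>
    step (Par Q P) TauA (nu b (Par Q' P'))"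

definition taus :: "proc \<Rightarrow> proc \<Rightarrow> bool" where
  "taus = (\<lambda>P P'. step P TauA P')\<^sup>*\<^sup>*"

definition wstep :: "proc \<Rightarrow> act \<Rightarrow> proc \<Rightarrow> bool" where
  "wstep P \<alpha> P' \<longleftrightarrow> (\<exists>P1 P2. taus P P1 \<and> step P1 \<alpha> P2 \<and> taus P2 P')"

definition wstep_hat :: "proc \<Rightarrow> act \<Rightarrow> proc \<Rightarrow> bool" where
  "wstep_hat P \<mu> P' \<longleftrightarrow> (if \<mu> = TauA then taus P P' else wstep P \<mu> P')"

definition step_hat :: "proc \<Rightarrow> act \<Rightarrow> proc \<Rightarrow> bool" where
  "step_hat P \<mu> P' \<longleftrightarrow> step P \<mu> P' \<or> \<mu> = TauA \<and> P' = P"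


section \<open>Bisimulation functions and expansion\<close>

text \<open>
  As usual for name-passing calculi, the bound name of an action is taken fresh for both processes
  being compared: a transition \<open>P \<rightarrow> P'\<close> labelled with a bound output of \<open>b\<close> already satisfies
  \<open>b \<notin> fn P\<close>, and it only has to be matched by \<open>Q\<close> if also \<open>b \<notin> fn Q\<close>.
\<close>

definition ws :: "proc rel \<Rightarrow> proc rel" where
  "ws R = {(P, Q). \<forall>\<mu> P'. bn \<mu> \<inter> fn Q = {} \<longrightarrow> step P \<mu> P' \<longrightarrow>
     (\<exists>Q'. wstep_hat Q \<mu> Q' \<and> (P', Q') \<in> R)}"

definition wb :: "proc rel \<Rightarrow> proc rel" where
  "wb R = {(P, Q). (P, Q) \<in> ws R \<and> (Q, P) \<in> ws (R\<inverse>)}"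

definition wb_bar :: "proc rel \<Rightarrow> proc rel" where
  "wb_bar R = R \<inter> wb R"

definition ss :: "proc rel \<Rightarrow> proc rel" where
  "ss R = {(P, Q). \<forall>\<mu> P'. bn \<mu> \<inter> fn Q = {} \<longrightarrow> step P \<mu> P' \<longrightarrow>
     (\<exists>Q'. step_hat Q \<mu> Q' \<and> (P', Q') \<in> R)}"

text \<open>
  \<open>(P, Q) \<in> expansion\<close> is \<open>P \<greatersim> Q\<close>, oriented so that \<open>Q\<close> is the process with
  fewer internal steps: \<open>Q\<close> answers each \<open>\<tau>\<close> of \<open>P\<close> with at most one \<open>\<tau>\<close>. With the opposite
  orientation \<open>up_exp\<close> below would be unsound: it would relate \<open>a\<close> to \<open>\<tau>.a\<close>, so
  that \<open>{(\<tau>.a, 0)}\<close> would be a bisimulation up to \<open>up_exp\<close>.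
\<close>

definition expansion :: "proc rel" where
  "expansion = \<Union>{R. \<forall>(P, Q) \<in> R. (P, Q) \<in> ss R \<and> (Q, P) \<in> ws (R\<inverse>)}"


section \<open>Up-to functions\<close>

definition up_exp :: "proc rel \<Rightarrow> proc rel" where
  "up_exp R = expansion O R O expansion\<inverse>"

definition up_refl :: "proc rel \<Rightarrow> proc rel" where
  "up_refl R = {(P, P) | P. True}"

definition up_sub :: "proc rel \<Rightarrow> proc rel" where
  "up_sub R = {(subst \<sigma> P, subst \<sigma> Q) | \<sigma> P Q. (P, Q) \<in> R}"

definition up_res :: "proc rel \<Rightarrow> proc rel" where
  "up_res R = {(nus as P, nus as Q) | as P Q. (P, Q) \<in> R}"

definition up_pcomp :: "proc rel \<Rightarrow> proc rel" where
  "up_pcomp R = {(Par P P', Par Q Q') | P P' Q Q'. (P, Q) \<in> R \<and> (P', Q') \<in> R}"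

definition up_rep :: "proc rel \<Rightarrow> proc rel" where
  "up_rep R = {(Bang G, Bang G') | G G'. (Grd G, Grd G') \<in> R}"

definition up_tau :: "proc rel \<Rightarrow> proc rel" where
  "up_tau R = {(Grd (Tau P), Grd (Tau Q)) | P Q. (P, Q) \<in> R}"

definition up_out :: "proc rel \<Rightarrow> proc rel" where
  "up_out R = {(Grd (Out a b P), Grd (Out a b Q)) | a b P Q. (P, Q) \<in> R}"

definition up_inp :: "proc rel \<Rightarrow> proc rel" where
  "up_inp R = {(Grd (inp a b P), Grd (inp a b Q)) | a b P Q. (P, Q) \<in> R}"

text \<open>
  Finite sums of pairwise related summands. Sums are binary in the syntax and not quotiented by
  associativity, so every bracketing is included; the empty sum is the reflexive pair of \<open>Zero\<close>.
\<close>

inductive_set up_sum :: "proc rel \<Rightarrow> proc rel" for R :: "proc rel" where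
  summand: "(Grd G, Grd G') \<in> up_tau R \<union> up_out R \<union> up_inp R \<union> up_refl R \<Longrightarrow>
    (Grd G, Grd G') \<in> up_sum R"
| plus: "(Grd G, Grd G') \<in> up_sum R \<Longrightarrow> (Grd H, Grd H') \<in> up_sum R \<Longrightarrow>
    (Grd (Sum G H), Grd (Sum G' H')) \<in> up_sum R"

text \<open>
  A calculus is a set \<open>C\<close> of processes, and relations are relations on \<open>C\<close>: the pairs an up-to
  function produces are those that lie in the calculus.
\<close>

definition up_base :: "proc set \<Rightarrow> proc rel \<Rightarrow> proc rel" where
  "up_base C R = (up_exp R \<union> R \<union> up_refl R \<union> up_sub R \<union> up_res R \<union> up_pcomp R \<union> up_sum R
     \<union> up_rep R \<union> up_tau R \<union> up_out R \<union> up_inp R) \<inter> C \<times> C"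

definition omega :: "(proc rel \<Rightarrow> proc rel) \<Rightarrow> proc rel \<Rightarrow> proc rel" where
  "omega f R = (\<Union>n. (f ^^ n) R)"

definition extensive_on :: "proc set \<Rightarrow> (proc rel \<Rightarrow> proc rel) \<Rightarrow> bool" where
  "extensive_on C f \<longleftrightarrow> (\<forall>R \<subseteq> C \<times> C. R \<subseteq> f R)"

definition sound_on :: "proc set \<Rightarrow> (proc rel \<Rightarrow> proc rel) \<Rightarrow> (proc rel \<Rightarrow> proc rel) \<Rightarrow> bool" where
  "sound_on C b f \<longleftrightarrow> (\<exists>f'. (\<forall>R \<subseteq> C \<times> C. f' R \<subseteq> C \<times> C) \<and> extensive_on C f' \<and>
     (\<forall>R \<subseteq> C \<times> C. R \<subseteq> b (f R) \<longrightarrow> f' R \<subseteq> b (f' R)))"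


section \<open>Calculi and the weak aliased communication property\<close>

text \<open>
  The transition system must restrict to the calculus: it is closed under transitions and, since the
  rule for replication passes through it, under the unfolding of \<open>!G\<close> into \<open>!G | G\<close>.
\<close>

definition calculus :: "proc set \<Rightarrow> bool" where
  "calculus C \<longleftrightarrow>
     (\<forall>P \<in> C. \<forall>\<mu> P'. step P \<mu> P' \<longrightarrow> P' \<in> C) \<and>
     (\<forall>G. Bang G \<in> C \<longrightarrow> Grd G \<in> C \<longrightarrow> Par (Bang G) (Grd G) \<in> C)"

text \<open>
  In the second clause \<open>b\<close> is bound in the conclusion, so \<open>\<sigma>\<close> is required not to touch it; as
  \<open>a \<noteq> b\<close>, this excludes \<open>c = b\<close>.
\<close>

definition weak_acp :: "proc set \<Rightarrow> bool" where
  "weak_acp C \<longleftrightarrow>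
     (\<forall>P \<in> C. \<forall>a b c P1 P'. wstep P (OutA a b) P1 \<longrightarrow> wstep P1 (InA c b) P' \<longrightarrow>
        (\<forall>\<sigma>. \<sigma> a = \<sigma> c \<longrightarrow> taus (subst \<sigma> P) (subst \<sigma> P'))) \<and>
     (\<forall>P \<in> C. \<forall>a b c P1 P'. wstep P (BOutA a b) P1 \<longrightarrow> wstep P1 (InA c b) P' \<longrightarrow>
        (\<forall>\<sigma>. \<sigma> a = \<sigma> c \<longrightarrow> fresh_for b \<sigma> \<longrightarrow> taus (subst \<sigma> P) (nu b (subst \<sigma> P'))))"

end

(*
  For a relation R as in the statement, the closure cl C R of R under all up-to operators is a weak
  bisimulation, shown by induction on the closure. The delicate operator is substitution: a
  tau-step of P sigma may come from an output and an input of P whose subjects are identified by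
  sigma. To answer it one first follows the output, which leads to a pair of the closure to which
  the induction hypothesis does not apply, and then the input. Hence visible actions are treated
  for the whole closure first; only then are tau-steps, and the weak aliased communication property
  turns the two visible answers into the required internal one. If the output is bound, the
  restriction created by the step sits deep inside the process, whereas the property puts it on
  top; the two processes are strongly bisimilar by scope extrusion, hence related by expansion.
*)

theory Submission
  imports Defs
begin

section \<open>Names and transitions\<close>

text \<open>Settling visible actions first is not circular: a visible action of a composite process
  comes from a visible action of a component, never from a \<tau>, so the induction for them never
  asks for an answer to a \<tau>. A \<tau>, in contrast, may come from two visible actions. The
  second obstacle is bound names. An intermediate process of an expansion, or the answering side of
  a communication, may contain the name being extruded, and opening a restriction needs a concrete
  name. So pairs of the closure are renamed all the time, also outside the calculus. The closure
  therefore admits two kinds of substitution: those injective on the free names, for any pair, and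
  arbitrary ones inside the calculus. They fit together, because only a substitution that is not
  injective can create a communication, and then the communication property is available. The
  closure also contains converses, which leaves a single direction of simulation to prove.\<close>

primrec act_subst :: "(name \<Rightarrow> name) \<Rightarrow> act \<Rightarrow> act" where
  "act_subst \<sigma> (OutA a b) = OutA (\<sigma> a) (\<sigma> b)"
| "act_subst \<sigma> (BOutA a b) = BOutA (\<sigma> a) (\<sigma> b)"
| "act_subst \<sigma> (InA a b) = InA (\<sigma> a) (\<sigma> b)"
| "act_subst \<sigma> TauA = TauA"

lemma act_subst_cong: "(\<And>x. x \<in> names \<mu> \<Longrightarrow> \<rho> x = \<sigma> x) \<Longrightarrow> act_subst \<rho> \<mu> = act_subst \<sigma> \<mu>"
  by (cases \<mu>) auto

lemma act_subst_comp: "act_subst \<rho> (act_subst \<sigma> \<mu>) = act_subst (\<rho> \<circ> \<sigma>) \<mu>"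
  by (cases \<mu>) auto

lemma act_subst_id [simp]: "act_subst id \<mu> = \<mu>"
  by (cases \<mu>) auto

lemma act_subst_eq_TauA [simp]: "act_subst \<sigma> \<mu> = TauA \<longleftrightarrow> \<mu> = TauA"
  by (cases \<mu>) auto

lemma bn_act_subst [simp]: "bn (act_subst \<sigma> \<mu>) = \<sigma> ` bn \<mu>"
  by (cases \<mu>) auto

lemma bn_names: "bn \<mu> \<subseteq> names \<mu>"
  by (cases \<mu>) auto

lemma finite_names [simp]: "finite (names \<mu>)"
  by (cases \<mu>) auto

lemma finite_pred_vimage: "finite A \<Longrightarrow> finite {n. Suc n \<in> A}"
  using finite_vimageI[of A Suc] by (simp add: vimage_def)

lemma finite_fn [simp]: "finite (fn P)" "finite (gfn G)"
  by (induction P and G) (simp_all add: finite_pred_vimage)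

lemma ex_fresh_name: "finite (X :: name set) \<Longrightarrow> \<exists>z. z \<notin> X"
  by (rule ex_new_if_finite) simp_all

text \<open>\<open>case_nat a id\<close> opens a binder: index 0 becomes the name \<open>a\<close>,
  the other indices move down. \<open>bind a\<close> undoes this only if \<open>a\<close> is fresh,
  since it would also capture a free \<open>a\<close> of the body.\<close>

lemma nu_case_nat: "a \<notin> fn (Nu P) \<Longrightarrow> nu a (subst (case_nat a id) P) = Nu P"
proof -
  assume "a \<notin> fn (Nu P)"
  then have "subst (bind a \<circ> case_nat a id) P = subst id P"
    by (intro subst_cong_fn) (auto simp: bind_def split: nat.split)
  then show ?thesis by (simp add: nu_def subst_subst)
qed

text \<open>In contrast to \<open>subst_nu\<close>, \<open>\<sigma>\<close> may move the bound name
  or map other names to it; the binder is renamed on the way to some \<open>z\<close> that captures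
  nothing.\<close>

lemma subst_nu_rename:
  assumes "z \<notin> \<sigma> ` (fn P - {a})"
  shows "subst \<sigma> (nu a P) = nu z (subst (\<sigma>(a := z)) P)"
  unfolding nu_def using assms
  by (auto simp: subst_subst bind_def lift_def intro!: subst_cong_fn)

lemma step_Inp: "step (Grd (Inp a P)) (InA a c) (subst (case_nat c id) P)"
proof -
  obtain b where b: "b \<notin> fn (Nu P)" using ex_fresh_name[of "fn (Nu P)"] finite_fn by blast
  then obtain Q where Q: "Inp a P = inp a b Q" using inp_exhaust by blast
  have "case_nat c id \<circ> bind b = id(b := c)" by (auto simp: bind_def)
  then show ?thesis using step.inp[of a b Q c] Q by (simp add: inp_def subst_subst)
qed

text \<open>Only \<open>open\<close> creates a bound output, and it acts on a restriction. The
  invariant includes the unfolding \<open>Par (Bang G) (Grd G)\<close> because the rule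
  \<open>rep\<close> passes through it.\<close>

lemma guarded_no_BOut: "\<not> step (Grd G) (BOutA a b) P'" "\<not> step (Bang G) (BOutA a b) P'"
proof -
  have "P \<noteq> Grd G \<and> P \<noteq> Bang G \<and> P \<noteq> Par (Bang G) (Grd G)" if "step P (BOutA a b) P'" for P
    using that
    by (induction P "BOutA a b" P' arbitrary: G rule: step.induct) (auto simp: nu_def)
  then show "\<not> step (Grd G) (BOutA a b) P'" "\<not> step (Bang G) (BOutA a b) P'" by auto
qed

text \<open>The extruded name is fresh for the source by the side conditions of \<open>open\<close>
  and of the parallel rules. The sum rules carry no such condition; there it holds because a sum has
  no bound output at all.\<close>

lemma step_names:
  assumes "step P \<mu> P'"
  shows "fn P' \<subseteq> fn P \<union> names \<mu> \<and> (\<forall>a b. \<mu> = OutA a b \<longrightarrow> a \<in> fn P \<and> b \<in> fn P) \<and>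
    (\<forall>a b. \<mu> = BOutA a b \<longrightarrow> a \<in> fn P \<and> b \<notin> fn P) \<and> (\<forall>a b. \<mu> = InA a b \<longrightarrow> a \<in> fn P)"
  using assms
proof induction
  case (inp a b P c)
  then show ?case by (auto simp: gfn_inp fn_subst)
next
  case (parL P \<mu> P' Q)
  then show ?case by (cases \<mu>) auto
next
  case (parR P \<mu> P' Q)
  then show ?case by (cases \<mu>) auto
next
  case (res P \<mu> P' a)
  then show ?case by (cases \<mu>) (auto simp: fn_nu)
next
  case (sumL G \<mu> P' G')
  then show ?case using guarded_no_BOut(1) by auto
next
  case (sumR G \<mu> P' G')
  then show ?case using guarded_no_BOut(1) by auto
qed (auto simp: fn_nu)

lemma step_Out_fn: "step P (OutA a b) P' \<Longrightarrow> a \<in> fn P \<and> b \<in> fn P \<and> fn P' \<subseteq> fn P"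
  by (drule step_names) auto

lemma step_BOut_fn: "step P (BOutA a b) P' \<Longrightarrow> a \<in> fn P \<and> b \<notin> fn P \<and> fn P' \<subseteq> insert b (fn P)"
  by (drule step_names) auto

lemma step_In_fn: "step P (InA a b) P' \<Longrightarrow> a \<in> fn P \<and> fn P' \<subseteq> insert b (fn P)"
  by (drule step_names) auto

lemma step_Tau_fn: "step P TauA P' \<Longrightarrow> fn P' \<subseteq> fn P"
  by (drule step_names) auto

lemma step_fn: "step P \<mu> P' \<Longrightarrow> fn P' \<subseteq> fn P \<union> names \<mu>"
  by (drule step_names) auto

lemma step_bn: "step P \<mu> P' \<Longrightarrow> bn \<mu> \<inter> fn P = {}"
  by (drule step_names, cases \<mu>) auto

text \<open>The side conditions of the rules concern bound names only. Those of restrictions and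
  closings can be renamed away from the range of \<open>\<sigma>\<close>, so the extruded name of
  the label is the only one to protect, and \<open>\<sigma>\<close> may identify other
  names.\<close>

lemma step_subst:
  assumes "step P \<mu> P'" and "\<And>b. b \<in> bn \<mu> \<Longrightarrow> \<sigma> b \<notin> \<sigma> ` fn P"
  shows "step (subst \<sigma> P) (act_subst \<sigma> \<mu>) (subst \<sigma> P')"
  using assms
proof (induction arbitrary: \<sigma>)
  case (inp a b P c)
  have "subst (case_nat (\<sigma> c) id) (subst (lift \<sigma>) (subst (bind b) P)) = subst \<sigma> (subst (id(b := c)) P)"
    by (auto simp: subst_subst lift_def bind_def intro!: subst_cong_fn)
  then show ?case using step_Inp[of "\<sigma> a" "subst (lift \<sigma>) (subst (bind b) P)" "\<sigma> c"]
    by (simp add: inp_def)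
next
  case (rep G \<mu> P')
  then show ?case using rep.IH[of \<sigma>] by (auto intro: step.rep)
next
  case ("open" P a b P')
  have ab: "a \<in> fn P" using open.hyps step_Out_fn by blast
  have b: "\<sigma> b \<notin> \<sigma> ` (fn P - {b})" using open.prems by (simp add: fn_nu)
  have eq: "subst \<sigma> (nu b P) = nu (\<sigma> b) (subst \<sigma> P)"
    using subst_nu_rename[OF b] by simp
  have "\<sigma> b \<noteq> \<sigma> a" using b ab \<open>b \<noteq> a\<close> by force
  then show ?case unfolding eq using open.IH[of \<sigma>] by (auto intro: step.open)
next
  case (res P \<mu> P' a)
  \<comment> \<open>Instead of \<open>a\<close>, which may clash with the range of
    \<open>\<sigma>\<close>, the fresh \<open>z\<close> is restricted;
    \<open>\<sigma>(a := z)\<close> agrees with \<open>\<sigma>\<close> on the label.\<close>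
  obtain z where z: "z \<notin> \<sigma> ` (fn P \<union> fn P' \<union> names \<mu>)"
    using ex_fresh_name[of "\<sigma> ` (fn P \<union> fn P' \<union> names \<mu>)"] by auto
  let ?\<sigma> = "\<sigma>(a := z)"
  have act: "act_subst ?\<sigma> \<mu> = act_subst \<sigma> \<mu>"
    by (rule act_subst_cong) (use res.hyps in auto)
  have "step (subst ?\<sigma> P) (act_subst ?\<sigma> \<mu>) (subst ?\<sigma> P')"
  proof (rule res.IH)
    fix b assume b: "b \<in> bn \<mu>"
    then have "b \<in> names \<mu>" using bn_names by blast
    then have "b \<noteq> a" "\<sigma> b \<noteq> z" using res.hyps z by auto
    then show "?\<sigma> b \<notin> ?\<sigma> ` fn P" using res.prems[OF b] by (auto simp: fn_nu image_iff)
  qed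
  moreover have "z \<notin> names (act_subst \<sigma> \<mu>)" using z by (cases \<mu>) auto
  ultimately have "step (nu z (subst ?\<sigma> P)) (act_subst \<sigma> \<mu>) (nu z (subst ?\<sigma> P'))"
    unfolding act by (rule step.res)
  moreover have "subst \<sigma> (nu a P) = nu z (subst ?\<sigma> P)" "subst \<sigma> (nu a P') = nu z (subst ?\<sigma> P')"
    using z by (intro subst_nu_rename; auto)+
  ultimately show ?case by simp
next
  case (parL P \<mu> P' Q)
  have "bn (act_subst \<sigma> \<mu>) \<inter> fn (subst \<sigma> Q) = {}"
    using parL.prems by (force simp: fn_subst)
  then show ?case using parL.IH[of \<sigma>] parL.prems by (auto intro!: step.parL)
next
  case (parR P \<mu> P' Q)
  have "bn (act_subst \<sigma> \<mu>) \<inter> fn (subst \<sigma> Q) = {}"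
    using parR.prems by (force simp: fn_subst)
  then show ?case using parR.IH[of \<sigma>] parR.prems by (auto intro!: step.parR)
next
  case (commL P a b P' Q Q')
  then show ?case using commL.IH[of \<sigma>] by (auto intro: step.commL)
next
  case (commR P a b P' Q Q')
  then show ?case using commR.IH[of \<sigma>] by (auto intro: step.commR)
next
  case (closeL P a b P' Q Q')
  obtain z where z: "z \<notin> \<sigma> ` (fn P \<union> fn Q \<union> fn P' \<union> fn Q')"
    using ex_fresh_name[of "\<sigma> ` (fn P \<union> fn Q \<union> fn P' \<union> fn Q')"] by auto
  let ?\<sigma> = "\<sigma>(b := z)"
  have fr: "b \<notin> fn P" "b \<notin> fn Q" "a \<noteq> b"
    using closeL.hyps step_BOut_fn step_In_fn by blast+
  have eq: "subst ?\<sigma> P = subst \<sigma> P" "subst ?\<sigma> Q = subst \<sigma> Q"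
    using fr by (auto intro!: subst_cong_fn)
  have "step (subst \<sigma> P) (InA (\<sigma> a) z) (subst ?\<sigma> P')"
  proof -
    have "step (subst ?\<sigma> P) (act_subst ?\<sigma> (InA a b)) (subst ?\<sigma> P')"
      by (rule closeL.IH) simp
    then show ?thesis using eq fr by simp
  qed
  moreover have "step (subst \<sigma> Q) (BOutA (\<sigma> a) z) (subst ?\<sigma> Q')"
  proof -
    have "step (subst ?\<sigma> Q) (act_subst ?\<sigma> (BOutA a b)) (subst ?\<sigma> Q')"
      by (rule closeL.IH) (use fr z in auto)
    then show ?thesis using eq fr by simp
  qed
  moreover have "z \<notin> fn (subst \<sigma> P)" using z by (auto simp: fn_subst)
  ultimately have "step (Par (subst \<sigma> P) (subst \<sigma> Q)) TauA (nu z (Par (subst ?\<sigma> P') (subst ?\<sigma> Q')))"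
    by (rule step.closeL)
  moreover have "subst \<sigma> (nu b (Par P' Q')) = nu z (subst ?\<sigma> (Par P' Q'))"
    by (rule subst_nu_rename) (use z in auto)
  ultimately show ?case by simp
next
  case (closeR P a b P' Q Q')
  obtain z where z: "z \<notin> \<sigma> ` (fn P \<union> fn Q \<union> fn P' \<union> fn Q')"
    using ex_fresh_name[of "\<sigma> ` (fn P \<union> fn Q \<union> fn P' \<union> fn Q')"] by auto
  let ?\<sigma> = "\<sigma>(b := z)"
  have fr: "b \<notin> fn P" "b \<notin> fn Q" "a \<noteq> b"
    using closeR.hyps step_BOut_fn step_In_fn by blast+
  have eq: "subst ?\<sigma> P = subst \<sigma> P" "subst ?\<sigma> Q = subst \<sigma> Q"
    using fr by (auto intro!: subst_cong_fn)
  have "step (subst \<sigma> P) (InA (\<sigma> a) z) (subst ?\<sigma> P')"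
  proof -
    have "step (subst ?\<sigma> P) (act_subst ?\<sigma> (InA a b)) (subst ?\<sigma> P')"
      by (rule closeR.IH) simp
    then show ?thesis using eq fr by simp
  qed
  moreover have "step (subst \<sigma> Q) (BOutA (\<sigma> a) z) (subst ?\<sigma> Q')"
  proof -
    have "step (subst ?\<sigma> Q) (act_subst ?\<sigma> (BOutA a b)) (subst ?\<sigma> Q')"
      by (rule closeR.IH) (use fr z in auto)
    then show ?thesis using eq fr by simp
  qed
  moreover have "z \<notin> fn (subst \<sigma> P)" using z by (auto simp: fn_subst)
  ultimately have "step (Par (subst \<sigma> Q) (subst \<sigma> P)) TauA (nu z (Par (subst ?\<sigma> Q') (subst ?\<sigma> P')))"
    by (rule step.closeR)
  moreover have "subst \<sigma> (nu b (Par Q' P')) = nu z (subst ?\<sigma> (Par Q' P'))"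
    by (rule subst_nu_rename) (use z in auto)
  ultimately show ?case by simp
qed (auto intro: step.intros)

section \<open>Transitions of nameless restrictions and of parallel compositions\<close>

lemma step_Nu_res:
  assumes "step P (act_subst Suc \<mu>) P'"
  shows "step (Nu P) \<mu> (Nu P')"
proof -
  obtain a where a: "a \<notin> names \<mu> \<union> fn (Nu P) \<union> fn (Nu P')"
    using ex_fresh_name[of "names \<mu> \<union> fn (Nu P) \<union> fn (Nu P')"] finite_fn finite_names by blast
  have "step (subst (case_nat a id) P) (act_subst (case_nat a id) (act_subst Suc \<mu>)) (subst (case_nat a id) P')"
  proof (rule step_subst[OF assms])
    fix b assume "b \<in> bn (act_subst Suc \<mu>)"
    then obtain b' where b: "b = Suc b'" "b' \<in> bn \<mu>" by auto
    then have "Suc b' \<notin> fn P" using step_bn[OF assms] by auto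
    moreover have "b' \<noteq> a" using a b bn_names[of \<mu>] by auto
    ultimately show "case_nat a id b \<notin> case_nat a id ` fn P"
      using b by (auto simp: image_iff split: nat.split_asm)
  qed
  moreover have "case_nat a id \<circ> Suc = id" by auto
  ultimately have "step (subst (case_nat a id) P) \<mu> (subst (case_nat a id) P')"
    by (simp add: act_subst_comp)
  then have "step (nu a (subst (case_nat a id) P)) \<mu> (nu a (subst (case_nat a id) P'))"
    by (rule step.res) (use a in auto)
  with a show ?thesis by (simp add: nu_case_nat)
qed

lemma step_Nu_open:
  assumes "step P (OutA (Suc a) 0) P'" and "b \<notin> fn (Nu P)"
  shows "step (Nu P) (BOutA a b) (subst (case_nat b id) P')"
proof -
  have "step (subst (case_nat b id) P) (OutA a b) (subst (case_nat b id) P')"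
    using step_subst[OF assms(1), of "case_nat b id"] by simp
  moreover have "b \<noteq> a" using assms step_Out_fn[OF assms(1)] by auto
  ultimately have "step (nu b (subst (case_nat b id) P)) (BOutA a b) (subst (case_nat b id) P')"
    by (rule step.open)
  with assms show ?thesis by (simp add: nu_case_nat)
qed

lemma bind_simps [simp]: "bind a a = 0" "x \<noteq> a \<Longrightarrow> bind a x = Suc x"
  by (simp_all add: bind_def)

lemma case_nat_bind [simp]: "case_nat a id (bind a x) = x"
  by (simp add: bind_def)

lemma subst_case_nat_bind [simp]: "subst (case_nat a id) (subst (bind a) P) = P"
  using subst_id(1)[of P] by (simp add: subst_subst comp_def id_def[symmetric])

lemma step_bind:
  assumes "step P \<mu> P'"
  shows "step (subst (bind a) P) (act_subst (bind a) \<mu>) (subst (bind a) P')"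
  using step_bn[OF assms] by (intro step_subst[OF assms]) (auto dest: injD[OF inj_bind])

lemma step_Nu_cases:
  assumes "step (Nu P) \<mu> P'"
  obtains (res) P0 where "step P (act_subst Suc \<mu>) P0" "P' = Nu P0"
  | ("open") a b P0 where "\<mu> = BOutA a b" "b \<notin> fn (Nu P)" "step P (OutA (Suc a) 0) P0"
      "P' = subst (case_nat b id) P0"
  using assms
proof cases
  case ("open" Q a b)
  then have "step (subst (bind b) Q) (OutA (Suc a) 0) (subst (bind b) P')"
    using step_bind[of Q "OutA a b" P' b] by simp
  moreover have "b \<notin> fn (Nu P)" using \<open>Nu P = nu b Q\<close> fn_nu[of b Q] by simp
  ultimately show ?thesis using that(2)[of a b "subst (bind b) P'"] \<open>Nu P = nu b Q\<close> \<open>\<mu> = BOutA a b\<close> by (simp add: nu_def)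
next
  case (res Q Q' a)
  have "act_subst (bind a) \<mu> = act_subst Suc \<mu>"
    by (rule act_subst_cong) (use \<open>a \<notin> names \<mu>\<close> in \<open>auto simp: bind_def\<close>)
  then show ?thesis using res that(1)[of "subst (bind a) Q'"] step_bind[OF res(3), of a]
    by (simp add: nu_def)
qed

text \<open>The closing name is bound in the derivative, so it can be moved outside any finite set
  \<open>X\<close>: the renaming \<open>id(b := z)\<close> fixes both components and changes the
  derivative only by alpha-conversion. Users of the rule choose \<open>X\<close> to suit the process
  that has to answer.\<close>

lemma step_Par_cases [consumes 2, case_names parL parR commL commR closeL closeR]:
  assumes "step (Par P Q) \<mu> R" and "finite X"
  obtains P' where "step P \<mu> P'" "bn \<mu> \<inter> fn Q = {}" "R = Par P' Q"
  | Q' where "step Q \<mu> Q'" "bn \<mu> \<inter> fn P = {}" "R = Par P Q'"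
  | a b P' Q' where "\<mu> = TauA" "step P (InA a b) P'" "step Q (OutA a b) Q'" "R = Par P' Q'"
  | a b P' Q' where "\<mu> = TauA" "step P (OutA a b) P'" "step Q (InA a b) Q'" "R = Par P' Q'"
  | a b P' Q' where "\<mu> = TauA" "step P (InA a b) P'" "step Q (BOutA a b) Q'" "b \<notin> fn P" "b \<notin> X"
      "R = nu b (Par P' Q')"
  | a b P' Q' where "\<mu> = TauA" "step P (BOutA a b) P'" "step Q (InA a b) Q'" "b \<notin> fn Q" "b \<notin> X"
      "R = nu b (Par P' Q')"
proof -
  have refresh: "\<exists>z P2 Q2. step P (InA a z) P2 \<and> step Q (BOutA a z) Q2 \<and> z \<notin> fn P \<and> z \<notin> X \<and>
      nu b (Par P1 Q1) = nu z (Par P2 Q2) \<and> nu b (Par Q1 P1) = nu z (Par Q2 P2)"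
    if "step P (InA a b) P1" "step Q (BOutA a b) Q1" "b \<notin> fn P" for P Q P1 Q1 a b
  proof -
    obtain z where z: "z \<notin> X \<union> fn P \<union> fn Q \<union> fn P1 \<union> fn Q1"
      using ex_fresh_name[of "X \<union> fn P \<union> fn Q \<union> fn P1 \<union> fn Q1"] assms(2) by auto
    let ?\<sigma> = "id(b := z)"
    have ab: "a \<noteq> b" "b \<notin> fn Q" using that step_In_fn step_BOut_fn by blast+
    have "subst ?\<sigma> P = subst id P" "subst ?\<sigma> Q = subst id Q"
      using that(3) ab by (intro subst_cong_fn; auto)+
    then have "step P (InA a z) (subst ?\<sigma> P1)" "step Q (BOutA a z) (subst ?\<sigma> Q1)"
      using step_subst[OF that(1), of ?\<sigma>] step_subst[OF that(2), of ?\<sigma>] ab z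
      by (auto simp: image_iff)
    moreover have "nu b (Par P1 Q1) = nu z (subst ?\<sigma> (Par P1 Q1))" "nu b (Par Q1 P1) = nu z (subst ?\<sigma> (Par Q1 P1))"
      using z by (intro nu_alpha; simp)+
    ultimately show ?thesis using z by auto
  qed
  from assms(1) show thesis
  proof cases
    case (closeL a b P' Q')
    then show ?thesis using refresh[OF closeL(3,4,5)] that(5) by auto
  next
    case (closeR Q' a b P')
    then show ?thesis using refresh[OF closeR(3,4,5)] that(6) by metis
  qed (use that in \<open>auto simp: nu_def\<close>)
qed

section \<open>Scope extrusion\<close>

text \<open>Exchanging two adjacent restrictions exchanges the indices 0 and 1 of their common body.
  In \<open>floats.res\<close> this moves the floating restriction past the enclosing one.\<close>

definition swap01 :: "name \<Rightarrow> name" where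
  "swap01 = case_nat 1 (case_nat 0 (\<lambda>n. Suc (Suc n)))"

lemma swap01_simps [simp]:
  "swap01 0 = Suc 0" "swap01 (Suc 0) = 0" "swap01 (Suc (Suc n)) = Suc (Suc n)"
  by (simp_all add: swap01_def)

lemma swap01_swap01 [simp]: "swap01 (swap01 n) = n"
  by (simp add: swap01_def split: nat.split)

lemma subst_swap01_swap01 [simp]: "subst swap01 (subst swap01 P) = P"
  using subst_id(1)[of P] by (simp add: subst_subst comp_def id_def)

lemma lift_simps [simp]: "lift \<sigma> 0 = 0" "lift \<sigma> (Suc n) = Suc (\<sigma> n)"
  by (simp_all add: lift_def)

text \<open>
  \<open>floats A B\<close> says that \<open>A\<close> has a restriction below parallel compositions and other restrictions,
  and that moving it to the top gives \<open>Nu B\<close>.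
\<close>

inductive floats :: "proc \<Rightarrow> proc \<Rightarrow> bool" where
  top: "floats (Nu P) P"
| parL: "floats A B \<Longrightarrow> floats (Par A Q) (Par B (subst Suc Q))"
| parR: "floats A B \<Longrightarrow> floats (Par Q A) (Par (subst Suc Q) B)"
| res: "floats A B \<Longrightarrow> floats (Nu A) (Nu (subst swap01 B))"

lemma floats_fn: "floats A B \<Longrightarrow> fn A = {n. Suc n \<in> fn B}"
proof (induction rule: floats.induct)
  case (res A B)
  have "Suc (Suc n) \<in> swap01 ` X \<longleftrightarrow> Suc (Suc n) \<in> X" for n X
    by (metis swap01_simps(3) swap01_swap01 image_iff)
  with res show ?case by (simp add: fn_subst)
qed (auto simp: fn_subst)

lemma floats_subst: "floats A B \<Longrightarrow> floats (subst \<sigma> A) (subst (lift \<sigma>) B)"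
proof (induction arbitrary: \<sigma> rule: floats.induct)
  case (parL A B Q)
  have "subst (lift \<sigma>) (subst Suc Q) = subst Suc (subst \<sigma> Q)"
    by (simp add: subst_subst comp_def)
  then show ?case using parL floats.parL by simp
next
  case (parR A B Q)
  have "subst (lift \<sigma>) (subst Suc Q) = subst Suc (subst \<sigma> Q)"
    by (simp add: subst_subst comp_def)
  then show ?case using parR floats.parR by simp
next
  case (res A B)
  have "lift (lift \<sigma>) (swap01 n) = swap01 (lift (lift \<sigma>) n)" for n
    by (simp add: swap01_def lift_def split: nat.split)
  then have "subst (lift (lift \<sigma>)) (subst swap01 B) = subst swap01 (subst (lift (lift \<sigma>)) B)"
    by (simp add: subst_subst comp_def)
  then show ?case using res.IH[of "lift \<sigma>"] floats.res by simp
qed (auto intro: floats.intros)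

lemma floats_nu: "floats A B \<Longrightarrow> floats (nu b A) (nu (Suc b) B)"
proof -
  assume "floats A B"
  then have "floats (nu b A) (Nu (subst swap01 (subst (lift (bind b)) B)))"
    unfolding nu_def by (intro floats.res floats_subst)
  moreover have "swap01 (lift (bind b) n) = bind (Suc b) n" for n
    by (cases n) (auto simp: bind_def)
  ultimately show ?thesis by (simp add: nu_def subst_subst comp_def)
qed

lemma step_Suc: "step P \<mu> P' \<Longrightarrow> step (subst Suc P) (act_subst Suc \<mu>) (subst Suc P')"
  by (rule step_subst, assumption) (use step_bn in auto)

text \<open>\<open>case_nat 0 id\<close> is a left inverse of \<open>Suc\<close>. Its value at 0 is
  a dummy: index 0 occurs neither in the shifted process nor in the shifted label, hence not in
  \<open>R\<close>.\<close>

lemma step_Suc_inv: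
  assumes "step (subst Suc Q) (act_subst Suc \<mu>) R"
  obtains Q' where "step Q \<mu> Q'" "R = subst Suc Q'"
proof -
  have "step (subst (case_nat 0 id) (subst Suc Q)) (act_subst (case_nat 0 id) (act_subst Suc \<mu>))
      (subst (case_nat 0 id) R)"
    by (rule step_subst[OF assms]) (use step_bn[OF assms] in \<open>auto simp: fn_subst\<close>)
  moreover have "case_nat 0 id \<circ> Suc = id" by auto
  ultimately have "step Q \<mu> (subst (case_nat 0 id) R)"
    by (simp add: subst_subst act_subst_comp)
  moreover have "R = subst Suc (subst (case_nat 0 id) R)"
  proof -
    have "names (act_subst Suc \<mu>) = Suc ` names \<mu>" by (cases \<mu>) auto
    then have "0 \<notin> fn R" using step_fn[OF assms] by (auto simp: fn_subst)
    then have "subst (Suc \<circ> case_nat 0 id) R = subst id R"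
      by (intro subst_cong_fn) (auto split: nat.split intro: gr0I)
    then show ?thesis by (simp add: subst_subst)
  qed
  ultimately show thesis by (rule that)
qed

lemma floats_parL_nu:
  "floats A B \<Longrightarrow> floats (nu b (Par A Q)) (nu (Suc b) (Par B (subst Suc Q)))"
  by (intro floats_nu floats.parL)

lemma floats_parR_nu:
  "floats A B \<Longrightarrow> floats (nu b (Par Q A)) (nu (Suc b) (Par (subst Suc Q) B))"
  by (intro floats_nu floats.parR)

lemma subst_case_nat_Suc [simp]: "subst (case_nat b id) (subst Suc Q) = Q"
  using subst_id(1)[of Q] by (simp add: subst_subst comp_def id_def)

lemma subst_bind_fresh: "b \<notin> fn Q \<Longrightarrow> subst (bind b) Q = subst Suc Q"
  by (intro subst_cong_fn) (auto simp: bind_def)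

lemma subst_bind_case_nat: "Suc b \<notin> fn Q \<Longrightarrow> subst (bind b) (subst (case_nat b id) Q) = Q"
proof -
  assume "Suc b \<notin> fn Q"
  then have "subst (bind b \<circ> case_nat b id) Q = subst id Q"
    by (intro subst_cong_fn) (auto simp: bind_def split: nat.split)
  then show ?thesis by (simp add: subst_subst)
qed

text \<open>Naming the outer of two exchanged restrictions is naming the one that was inner before
  the exchange.\<close>

lemma swap01_Nu_subst:
  "subst (case_nat b id) (Nu (subst swap01 B)) = Nu (subst (case_nat (Suc b) id) B)"
proof -
  have "lift (case_nat b id) (swap01 n) = case_nat (Suc b) id n" for n
    by (simp add: swap01_def split: nat.split)
  then show ?thesis by (simp add: subst_subst comp_def)
qed

lemma swap01_lift_subst:
  "subst (case_nat (Suc b) id) (subst swap01 B) = subst (lift (case_nat b id)) B"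
proof -
  have "case_nat (Suc b) id (swap01 n) = lift (case_nat b id) n" for n
    by (simp add: swap01_def lift_def split: nat.split)
  then show ?thesis by (simp add: subst_subst comp_def)
qed

lemma step_swap01:
  assumes "step P \<mu> P'"
  shows "step (subst swap01 P) (act_subst swap01 \<mu>) (subst swap01 P')"
proof -
  have "inj swap01" by (metis swap01_swap01 injI)
  then show ?thesis using step_bn[OF assms] by (intro step_subst[OF assms]) (auto dest: injD)
qed

lemma act_swap01 [simp]: "act_subst swap01 (act_subst Suc (act_subst Suc \<mu>)) = act_subst Suc (act_subst Suc \<mu>)"
  by (cases \<mu>) auto

text \<open>Either the floating restriction survives the transition and still floats, or it is
  extruded to the environment. In the second case \<open>B\<close>, which lacks the restriction,
  outputs index 0, and naming that index \<open>b\<close> gives the same derivative.\<close>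

lemma floats_step:
  assumes "floats A B" and "step A \<mu> A'"
  shows "(\<exists>B'. step B (act_subst Suc \<mu>) B' \<and> floats A' B') \<or>
    (\<exists>a b B'. \<mu> = BOutA a b \<and> b \<notin> fn A \<and> step B (OutA (Suc a) 0) B' \<and> A' = subst (case_nat b id) B')"
  using assms
proof (induction arbitrary: \<mu> A' rule: floats.induct)
  case (top P)
  then show ?case by (cases rule: step_Nu_cases) (auto intro: floats.top)
next
  case (parL A B Q)
  have fnA: "fn A = {n. Suc n \<in> fn B}" using parL.hyps by (rule floats_fn)
  have "finite ({} :: name set)" by simp
  with parL.prems show ?case
  proof (cases rule: step_Par_cases)
    case 1: (parL A1)
    have "bn (act_subst Suc \<mu>) \<inter> fn (subst Suc Q) = {}" using 1 by (auto simp: fn_subst)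
    with parL.IH[OF 1(1)] 1 show ?thesis
      by (fastforce intro: step.parL floats.parL simp: fn_subst)
  next
    case (parR Q1)
    have "bn (act_subst Suc \<mu>) \<inter> fn B = {}" using parR fnA by auto
    with parR parL.hyps show ?thesis
      by (auto intro!: exI[of _ "Par B (subst Suc Q1)"] step.parR step_Suc floats.parL)
  next
    case (commL a b A1 Q1)
    then obtain B1 where "step B (InA (Suc a) (Suc b)) B1" "floats A1 B1"
      using parL.IH[of "InA a b" A1] by auto
    with commL step_Suc[OF commL(3)] show ?thesis by (auto intro: step.commL floats.parL)
  next
    case (commR a b A1 Q1)
    then obtain B1 where "step B (OutA (Suc a) (Suc b)) B1" "floats A1 B1"
      using parL.IH[of "OutA a b" A1] by auto
    with commR step_Suc[OF commR(3)] show ?thesis by (auto intro: step.commR floats.parL)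
  next
    case (closeL a b A1 Q1)
    then obtain B1 where "step B (InA (Suc a) (Suc b)) B1" "floats A1 B1"
      using parL.IH[of "InA a b" A1] by auto
    with closeL step_Suc[OF closeL(3)] fnA show ?thesis
      by (auto intro!: exI[of _ "nu (Suc b) (Par B1 (subst Suc Q1))"] step.closeL floats_parL_nu)
  next
    case (closeR a b A1 Q1)
    from parL.IH[OF closeR(2)] consider
        (i) B1 where "step B (BOutA (Suc a) (Suc b)) B1" "floats A1 B1"
      | (ii) B1 where "step B (OutA (Suc a) 0) B1" "A1 = subst (case_nat b id) B1"
      by auto
    then show ?thesis
    proof cases
      case i
      with closeR step_Suc[OF closeR(3)] show ?thesis
        by (auto intro!: exI[of _ "nu (Suc b) (Par B1 (subst Suc Q1))"] step.closeR floats_parL_nu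
            simp: fn_subst)
    next
      \<comment> \<open>The floating name itself is received by the parallel component. The closing
        puts its restriction on top of the derivative at once, so \<open>B\<close> answers by a
        plain communication of index 0 and the result is related by
        \<open>floats.top\<close>.\<close>
      case ii
      have "a \<noteq> b" using closeR step_In_fn by blast
      then have "step (subst Suc Q) (InA (Suc a) 0) (subst (bind b) Q1)"
        using step_bind[OF closeR(3), of b] closeR(4) by (simp add: subst_bind_fresh)
      then have "step (Par B (subst Suc Q)) TauA (Par B1 (subst (bind b) Q1))"
        using ii step.commR by blast
      moreover have "Suc b \<notin> fn B1"
        using step_BOut_fn[OF closeR(2)] step_Out_fn[OF ii(1)] fnA by auto
      then have "A' = Nu (Par B1 (subst (bind b) Q1))"
        using closeR ii by (simp add: nu_def subst_bind_case_nat)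
      ultimately show ?thesis using closeR(1) floats.top by auto
    qed
  qed
next
  case (parR A B Q)
  have fnA: "fn A = {n. Suc n \<in> fn B}" using parR.hyps by (rule floats_fn)
  have "finite ({} :: name set)" by simp
  with parR.prems show ?case
  proof (cases rule: step_Par_cases)
    case 1: (parR A1)
    have "bn (act_subst Suc \<mu>) \<inter> fn (subst Suc Q) = {}" using 1 by (auto simp: fn_subst)
    with parR.IH[OF 1(1)] 1 show ?thesis
      by (fastforce intro: step.parR floats.parR simp: fn_subst)
  next
    case (parL Q1)
    have "bn (act_subst Suc \<mu>) \<inter> fn B = {}" using parL fnA by auto
    with parL parR.hyps show ?thesis
      by (auto intro!: exI[of _ "Par (subst Suc Q1) B"] step.parL step_Suc floats.parR)
  next
    case (commR a b Q1 A1)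
    then obtain B1 where "step B (InA (Suc a) (Suc b)) B1" "floats A1 B1"
      using parR.IH[of "InA a b" A1] by auto
    with commR step_Suc[OF commR(2)] show ?thesis by (auto intro: step.commR floats.parR)
  next
    case (commL a b Q1 A1)
    then obtain B1 where "step B (OutA (Suc a) (Suc b)) B1" "floats A1 B1"
      using parR.IH[of "OutA a b" A1] by auto
    with commL step_Suc[OF commL(2)] show ?thesis by (auto intro: step.commL floats.parR)
  next
    case (closeR a b Q1 A1)
    then obtain B1 where "step B (InA (Suc a) (Suc b)) B1" "floats A1 B1"
      using parR.IH[of "InA a b" A1] by auto
    with closeR step_Suc[OF closeR(2)] fnA show ?thesis
      by (auto intro!: exI[of _ "nu (Suc b) (Par (subst Suc Q1) B1)"] step.closeR floats_parR_nu)
  next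
    case (closeL a b Q1 A1)
    from parR.IH[OF closeL(3)] consider
        (i) B1 where "step B (BOutA (Suc a) (Suc b)) B1" "floats A1 B1"
      | (ii) B1 where "step B (OutA (Suc a) 0) B1" "A1 = subst (case_nat b id) B1"
      by auto
    then show ?thesis
    proof cases
      case i
      with closeL step_Suc[OF closeL(2)] show ?thesis
        by (auto intro!: exI[of _ "nu (Suc b) (Par (subst Suc Q1) B1)"] step.closeL floats_parR_nu
            simp: fn_subst)
    next
      case ii
      have "a \<noteq> b" using closeL step_In_fn by blast
      then have "step (subst Suc Q) (InA (Suc a) 0) (subst (bind b) Q1)"
        using step_bind[OF closeL(2), of b] closeL(4) by (simp add: subst_bind_fresh)
      then have "step (Par (subst Suc Q) B) TauA (Par (subst (bind b) Q1) B1)"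
        using ii step.commL by blast
      moreover have "Suc b \<notin> fn B1"
        using step_BOut_fn[OF closeL(3)] step_Out_fn[OF ii(1)] fnA by auto
      then have "A' = Nu (Par (subst (bind b) Q1) B1)"
        using closeL ii by (simp add: nu_def subst_bind_case_nat)
      ultimately show ?thesis using closeL(1) floats.top by auto
    qed
  qed
next
  case (res A B)
  have fnA: "fn A = {n. Suc n \<in> fn B}" using res.hyps by (rule floats_fn)
  have fnN: "fn (Nu A) = {n. Suc n \<in> fn (Nu (subst swap01 B))}"
    using floats_fn[OF floats.res[OF res.hyps]] .
  from res.prems show ?case
  proof (cases rule: step_Nu_cases)
    case 1: (res A1)
    from res.IH[OF 1(1)] consider
        (i) B1 where "step B (act_subst Suc (act_subst Suc \<mu>)) B1" "floats A1 B1"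
      | (ii) a b B1 where "\<mu> = BOutA a b" "Suc b \<notin> fn A" "step B (OutA (Suc (Suc a)) 0) B1"
          "A1 = subst (case_nat (Suc b) id) B1"
      by (cases \<mu>) auto
    then show ?thesis
    proof cases
      case i
      then have "step (Nu (subst swap01 B)) (act_subst Suc \<mu>) (Nu (subst swap01 B1))"
        using step_swap01[OF i(1)] by (intro step_Nu_res) simp
      with i 1 show ?thesis by (auto intro: floats.res)
    next
      case ii
      then have "step (Nu (subst swap01 B)) (OutA (Suc a) 0) (Nu (subst swap01 B1))"
        using step_swap01[OF ii(3)] by (intro step_Nu_res) simp
      with ii 1 show ?thesis
        by (intro disjI2 exI[of _ a] exI[of _ b] exI[of _ "Nu (subst swap01 B1)"])
          (auto simp: swap01_Nu_subst[symmetric] simp del: subst.simps)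
    qed
  next
    \<comment> \<open>Here the enclosing restriction is extruded, not the floating one:
      \<open>A\<close> outputs index 0, which is index 1 in \<open>B\<close> and index 0 again after
      the swap.\<close>
    case op: ("open" a b A1)
    then obtain B1 where B1: "step B (OutA (Suc (Suc a)) (Suc 0)) B1" "floats A1 B1"
      using res.IH[of "OutA (Suc a) 0" A1] by auto
    then have "step (Nu (subst swap01 B)) (BOutA (Suc a) (Suc b)) (subst (case_nat (Suc b) id) (subst swap01 B1))"
      using step_swap01[OF B1(1)] op fnN by (intro step_Nu_open) auto
    then show ?thesis
      using op floats_subst[OF B1(2), of "case_nat b id"] by (auto simp: swap01_lift_subst)
  qed
qed

text \<open>The two parts depend on each other: a communication of index 0 inside \<open>B\<close>
  becomes a closing inside \<open>A\<close>, and the bound output needed for it is supplied by the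
  second part.\<close>

lemma floats_step_inv:
  assumes "floats A B"
  shows "step B (act_subst Suc \<mu>) B' \<Longrightarrow> \<exists>A'. step A \<mu> A' \<and> floats A' B'"
    and "step B (OutA (Suc a) 0) B' \<Longrightarrow> b \<notin> fn A \<Longrightarrow> step A (BOutA a b) (subst (case_nat b id) B')"
  using assms
proof (induction arbitrary: \<mu> a b B' rule: floats.induct)
  case (top P)
  case 1 then show ?case by (auto intro: step_Nu_res floats.top)
next
  case (top P)
  case 2 then show ?case by (auto intro: step_Nu_open)
next
  case (parL A B Q)
  have fnA: "fn A = {n. Suc n \<in> fn B}" using parL.hyps by (rule floats_fn)
  case 1
  \<comment> \<open>Closing names of \<open>B\<close> are kept different from index 0, the floating
    name, so that each is some \<open>Suc b\<close> and corresponds to a name \<open>b\<close> of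
    \<open>A\<close>.\<close>
  have "finite {0 :: name}" by simp
  with 1 show ?case
  proof (cases rule: step_Par_cases)
    case step: (parL B1)
    have "bn \<mu> \<inter> fn Q = {}" using step by (auto simp: fn_subst)
    with parL.IH(1)[OF step(1)] step show ?thesis by (auto intro: step.parL floats.parL)
  next
    case (parR Q1')
    obtain Q1 where "step Q \<mu> Q1" "Q1' = subst Suc Q1" using parR(1) by (rule step_Suc_inv)
    with parR fnA parL.hyps show ?thesis by (fastforce intro: step.parR floats.parL)
  next
    case (commL a' b' B1 Q1')
    then obtain a b where ab: "a' = Suc a" "b' = Suc b"
      using step_Out_fn[OF commL(3)] by (auto simp: fn_subst)
    obtain Q1 where "step Q (OutA a b) Q1" "Q1' = subst Suc Q1"
      using commL(3) ab by (auto elim: step_Suc_inv[of Q "OutA a b", simplified])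
    moreover obtain A1 where "step A (InA a b) A1" "floats A1 B1"
      using parL.IH(1)[of "InA a b" B1] commL ab by auto
    ultimately show ?thesis using commL by (auto intro: step.commL floats.parL)
  next
    case (commR a' b' B1 Q1')
    then obtain a where a: "a' = Suc a"
      using step_In_fn[OF commR(3)] by (auto simp: fn_subst)
    show ?thesis
    proof (cases b')
      case 0
      \<comment> \<open>The floating name is transmitted to \<open>Q\<close>: \<open>A\<close>
        extrudes it under a fresh name \<open>b\<close>, and the closing restricts it again.\<close>
      obtain b where b: "b \<notin> fn A \<union> fn Q \<union> fn (Nu (Par B1 Q1'))"
        using ex_fresh_name[of "fn A \<union> fn Q \<union> fn (Nu (Par B1 Q1'))"] finite_fn by blast
      have "step A (BOutA a b) (subst (case_nat b id) B1)"
        by (rule parL.IH(2)) (use commR 0 a b in auto)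
      moreover have "step Q (InA a b) (subst (case_nat b id) Q1')"
        using step_subst[OF commR(3), of "case_nat b id"] 0 a by simp
      ultimately have "step (Par A Q) TauA (nu b (subst (case_nat b id) (Par B1 Q1')))"
        using b by (auto intro: step.closeR)
      then show ?thesis using commR b by (auto simp: nu_case_nat simp del: subst.simps intro: floats.top)
    next
      case (Suc b)
      obtain Q1 where "step Q (InA a b) Q1" "Q1' = subst Suc Q1"
        using commR(3) a Suc by (auto elim: step_Suc_inv[of Q "InA a b", simplified])
      moreover obtain A1 where "step A (OutA a b) A1" "floats A1 B1"
        using parL.IH(1)[of "OutA a b" B1] commR a Suc by auto
      ultimately show ?thesis using commR by (auto intro: step.commR floats.parL)
    qed
  next
    case (closeL a' b' B1 Q1')
    then obtain a b where ab: "a' = Suc a" "b' = Suc b"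
      using step_BOut_fn[OF closeL(3)] by (cases b') (auto simp: fn_subst)
    obtain Q1 where "step Q (BOutA a b) Q1" "Q1' = subst Suc Q1"
      using closeL(3) ab by (auto elim: step_Suc_inv[of Q "BOutA a b", simplified])
    moreover obtain A1 where "step A (InA a b) A1" "floats A1 B1"
      using parL.IH(1)[of "InA a b" B1] closeL ab by auto
    moreover have "b \<notin> fn A" using fnA closeL ab by auto
    ultimately show ?thesis using closeL ab by (auto intro!: exI step.closeL floats_parL_nu)
  next
    case (closeR a' b' B1 Q1')
    then obtain a b where ab: "a' = Suc a" "b' = Suc b"
      using step_In_fn[OF closeR(3)] by (cases b') (auto simp: fn_subst)
    obtain Q1 where "step Q (InA a b) Q1" "Q1' = subst Suc Q1"
      using closeR(3) ab by (auto elim: step_Suc_inv[of Q "InA a b", simplified])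
    moreover obtain A1 where "step A (BOutA a b) A1" "floats A1 B1"
      using parL.IH(1)[of "BOutA a b" B1] closeR ab by auto
    moreover have "b \<notin> fn Q" using closeR ab by (auto simp: fn_subst)
    ultimately show ?thesis using closeR ab by (auto intro!: exI step.closeR floats_parL_nu)
  qed
next
  case (parL A B Q)
  case 2
  have "finite {0 :: name}" by simp
  with 2(1) show ?case
  proof (cases rule: step_Par_cases)
    case step: (parL B1)
    then show ?thesis using parL.IH(2)[OF step(1)] 2(2) by (auto intro: step.parL)
  next
    case (parR Q1')
    then show ?thesis using step_Out_fn[OF parR(1)] by (auto simp: fn_subst)
  qed auto
next
  case (parR A B Q)
  have fnA: "fn A = {n. Suc n \<in> fn B}" using parR.hyps by (rule floats_fn)
  case 1
  have "finite {0 :: name}" by simp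
  with 1 show ?case
  proof (cases rule: step_Par_cases)
    case step: (parR B1)
    have "bn \<mu> \<inter> fn Q = {}" using step by (auto simp: fn_subst)
    with parR.IH(1)[OF step(1)] step show ?thesis by (auto intro: step.parR floats.parR)
  next
    case (parL Q1')
    obtain Q1 where "step Q \<mu> Q1" "Q1' = subst Suc Q1" using parL(1) by (rule step_Suc_inv)
    with parL fnA parR.hyps show ?thesis by (fastforce intro: step.parL floats.parR)
  next
    case (commR a' b' Q1' B1)
    then obtain a b where ab: "a' = Suc a" "b' = Suc b"
      using step_Out_fn[OF commR(2)] by (auto simp: fn_subst)
    obtain Q1 where "step Q (OutA a b) Q1" "Q1' = subst Suc Q1"
      using commR(2) ab by (auto elim: step_Suc_inv[of Q "OutA a b", simplified])
    moreover obtain A1 where "step A (InA a b) A1" "floats A1 B1"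
      using parR.IH(1)[of "InA a b" B1] commR ab by auto
    ultimately show ?thesis using commR by (auto intro: step.commR floats.parR)
  next
    case (commL a' b' Q1' B1)
    then obtain a where a: "a' = Suc a"
      using step_In_fn[OF commL(2)] by (auto simp: fn_subst)
    show ?thesis
    proof (cases b')
      case 0
      obtain b where b: "b \<notin> fn A \<union> fn Q \<union> fn (Nu (Par Q1' B1))"
        using ex_fresh_name[of "fn A \<union> fn Q \<union> fn (Nu (Par Q1' B1))"] finite_fn by blast
      have "step A (BOutA a b) (subst (case_nat b id) B1)"
        by (rule parR.IH(2)) (use commL 0 a b in auto)
      moreover have "step Q (InA a b) (subst (case_nat b id) Q1')"
        using step_subst[OF commL(2), of "case_nat b id"] 0 a by simp
      ultimately have "step (Par Q A) TauA (nu b (subst (case_nat b id) (Par Q1' B1)))"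
        using b by (auto intro: step.closeL)
      then show ?thesis using commL b by (auto simp: nu_case_nat simp del: subst.simps intro: floats.top)
    next
      case (Suc b)
      obtain Q1 where "step Q (InA a b) Q1" "Q1' = subst Suc Q1"
        using commL(2) a Suc by (auto elim: step_Suc_inv[of Q "InA a b", simplified])
      moreover obtain A1 where "step A (OutA a b) A1" "floats A1 B1"
        using parR.IH(1)[of "OutA a b" B1] commL a Suc by auto
      ultimately show ?thesis using commL by (auto intro: step.commL floats.parR)
    qed
  next
    case (closeR a' b' Q1' B1)
    then obtain a b where ab: "a' = Suc a" "b' = Suc b"
      using step_BOut_fn[OF closeR(2)] by (cases b') (auto simp: fn_subst)
    obtain Q1 where "step Q (BOutA a b) Q1" "Q1' = subst Suc Q1"
      using closeR(2) ab by (auto elim: step_Suc_inv[of Q "BOutA a b", simplified])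
    moreover obtain A1 where "step A (InA a b) A1" "floats A1 B1"
      using parR.IH(1)[of "InA a b" B1] closeR ab by auto
    moreover have "b \<notin> fn A" using fnA closeR ab by auto
    ultimately show ?thesis using closeR ab by (auto intro!: exI step.closeR floats_parR_nu)
  next
    case (closeL a' b' Q1' B1)
    then obtain a b where ab: "a' = Suc a" "b' = Suc b"
      using step_In_fn[OF closeL(2)] by (cases b') (auto simp: fn_subst)
    obtain Q1 where "step Q (InA a b) Q1" "Q1' = subst Suc Q1"
      using closeL(2) ab by (auto elim: step_Suc_inv[of Q "InA a b", simplified])
    moreover obtain A1 where "step A (BOutA a b) A1" "floats A1 B1"
      using parR.IH(1)[of "BOutA a b" B1] closeL ab by auto
    moreover have "b \<notin> fn Q" using closeL ab by (auto simp: fn_subst)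
    ultimately show ?thesis using closeL ab by (auto intro!: exI step.closeL floats_parR_nu)
  qed
next
  case (parR A B Q)
  case 2
  have "finite {0 :: name}" by simp
  with 2(1) show ?case
  proof (cases rule: step_Par_cases)
    case step: (parR B1)
    then show ?thesis using parR.IH(2)[OF step(1)] 2(2) by (auto intro: step.parR)
  next
    case (parL Q1')
    then show ?thesis using step_Out_fn[OF parL(1)] by (auto simp: fn_subst)
  qed auto
next
  case (res A B)
  have fnN: "fn (Nu A) = {n. Suc n \<in> fn (Nu (subst swap01 B))}"
    using floats_fn[OF floats.res[OF res.hyps]] .
  case 1
  then show ?case
  proof (cases rule: step_Nu_cases)
    case step: (res Y)
    have "step B (act_subst Suc (act_subst Suc \<mu>)) (subst swap01 Y)"
      using step_swap01[OF step(1)] by simp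
    then obtain A1 where "step A (act_subst Suc \<mu>) A1" "floats A1 (subst swap01 Y)"
      using res.IH(1) by blast
    then show ?thesis using step floats.res[of A1 "subst swap01 Y"] by (auto intro: step_Nu_res)
  next
    case op: ("open" a1 b1 Y)
    then obtain a b where \<mu>: "\<mu> = BOutA a b" "a1 = Suc a" "b1 = Suc b" by (cases \<mu>) auto
    have "step B (OutA (Suc (Suc a)) (Suc 0)) (subst swap01 Y)"
      using step_swap01[OF op(3)] \<mu> by simp
    then obtain A1 where A1: "step A (OutA (Suc a) 0) A1" "floats A1 (subst swap01 Y)"
      using res.IH(1)[of "OutA (Suc a) 0" "subst swap01 Y"] by auto
    have "step (Nu A) (BOutA a b) (subst (case_nat b id) A1)"
      using A1 op \<mu> fnN by (intro step_Nu_open) auto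
    moreover have "floats (subst (case_nat b id) A1) B'"
      using floats_subst[OF A1(2), of "case_nat b id"] op \<mu>
      by (simp add: swap01_lift_subst[symmetric])
    ultimately show ?thesis using \<mu> by blast
  qed
next
  case (res A B)
  case 2
  from 2(1) show ?case
  proof (cases rule: step_Nu_cases)
    case step: (res Y)
    have "step B (OutA (Suc (Suc a)) 0) (subst swap01 Y)"
      using step_swap01[OF step(1)] by simp
    then have "step A (BOutA (Suc a) (Suc b)) (subst (case_nat (Suc b) id) (subst swap01 Y))"
      using res.IH(2) 2(2) by auto
    then have "step (Nu A) (BOutA a b) (Nu (subst (case_nat (Suc b) id) (subst swap01 Y)))"
      by (intro step_Nu_res) simp
    then show ?thesis using step swap01_Nu_subst[of b "subst swap01 Y"] by simp
  qed auto
qed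

section \<open>Transitions of substituted processes\<close>

text \<open>
  \<open>pre_step P \<sigma> z \<mu> P'\<close> explains \<open>subst \<sigma> P \<rightarrow> P'\<close> by transitions of \<open>P\<close> that use the fresh name
  \<open>z\<close> for names that are received or extruded. Besides the \<open>\<tau>\<close>-steps of \<open>P\<close> itself there are those
  in which \<open>\<sigma>\<close> identifies the subjects \<open>a\<close> and \<open>c\<close> of an output and a parallel input.
\<close>

primrec pre_step :: "proc \<Rightarrow> (name \<Rightarrow> name) \<Rightarrow> name \<Rightarrow> act \<Rightarrow> proc \<Rightarrow> bool" where
  "pre_step P \<sigma> z (OutA a b) P' \<longleftrightarrow>
    (\<exists>a0 b0 P0. step P (OutA a0 b0) P0 \<and> \<sigma> a0 = a \<and> \<sigma> b0 = b \<and> P' = subst \<sigma> P0)"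
| "pre_step P \<sigma> z (BOutA a b) P' \<longleftrightarrow>
    (\<exists>a0 P0. step P (BOutA a0 z) P0 \<and> \<sigma> a0 = a \<and> P' = subst (\<sigma>(z := b)) P0)"
| "pre_step P \<sigma> z (InA a b) P' \<longleftrightarrow>
    (\<exists>a0 P0. step P (InA a0 z) P0 \<and> \<sigma> a0 = a \<and> P' = subst (\<sigma>(z := b)) P0)"
| "pre_step P \<sigma> z TauA P' \<longleftrightarrow>
    (\<exists>P0. step P TauA P0 \<and> P' = subst \<sigma> P0) \<or>
    (\<exists>a b c P1 P2. a \<noteq> c \<and> \<sigma> a = \<sigma> c \<and> step P (OutA a b) P1 \<and> step P1 (InA c b) P2 \<and>
      P' = subst \<sigma> P2) \<or>
    (\<exists>a c P1 P2. a \<noteq> c \<and> c \<noteq> z \<and> \<sigma> a = \<sigma> c \<and> step P (BOutA a z) P1 \<and> step P1 (InA c z) P2 \<and>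
      floats P' (subst (lift \<sigma>) (subst (bind z) P2)))"

lemma pre_step_mono:
  assumes "pre_step P \<sigma> z \<mu> P'" and "\<And>\<mu> P'. step P \<mu> P' \<Longrightarrow> step Q \<mu> P'"
  shows "pre_step Q \<sigma> z \<mu> P'"
  using assms(1)
  by (cases \<mu>; simp only: pre_step.simps; elim disjE exE conjE; blast intro: assms(2))

lemma pre_step_tau: "step P TauA P0 \<Longrightarrow> P' = subst \<sigma> P0 \<Longrightarrow> pre_step P \<sigma> z TauA P'"
  by auto

lemma pre_step_alias:
  "a \<noteq> c \<Longrightarrow> \<sigma> a = \<sigma> c \<Longrightarrow> step P (OutA a b) P1 \<Longrightarrow> step P1 (InA c b) P2 \<Longrightarrow> P' = subst \<sigma> P2 \<Longrightarrow>
    pre_step P \<sigma> z TauA P'"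
  unfolding pre_step.simps by metis

lemma pre_step_alias_bound:
  "a \<noteq> c \<Longrightarrow> c \<noteq> z \<Longrightarrow> \<sigma> a = \<sigma> c \<Longrightarrow> step P (BOutA a z) P1 \<Longrightarrow> step P1 (InA c z) P2 \<Longrightarrow>
    floats P' (subst (lift \<sigma>) (subst (bind z) P2)) \<Longrightarrow> pre_step P \<sigma> z TauA P'"
  unfolding pre_step.simps by metis

lemma subst_fresh_upd: "z \<notin> fn Q \<Longrightarrow> subst (\<sigma>(z := b)) Q = subst \<sigma> Q"
  by (intro subst_cong_fn) auto

lemma subst_lift_bind_fresh: "z \<notin> fn Q \<Longrightarrow> subst (lift \<sigma>) (subst (bind z) Q) = subst Suc (subst \<sigma> Q)"
  by (simp add: subst_bind_fresh subst_subst comp_def)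

lemma pre_step_parL:
  assumes "pre_step P \<sigma> z \<mu> P'" and "z \<notin> fn Q"
  shows "pre_step (Par P Q) \<sigma> z \<mu> (Par P' (subst \<sigma> Q))"
proof (cases \<mu>)
  case (OutA a b)
  then show ?thesis using assms step.parL[of P "OutA _ _" _ Q] by fastforce
next
  case (BOutA a b)
  then show ?thesis using assms step.parL[of P "BOutA _ z" _ Q] by (fastforce simp: subst_fresh_upd)
next
  case (InA a b)
  then show ?thesis using assms step.parL[of P "InA _ _" _ Q] by (fastforce simp: subst_fresh_upd)
next
  case TauA
  with assms(1) consider
      (tau) P0 where "step P TauA P0" "P' = subst \<sigma> P0"
    | (aliased) a b c P1 P2 where "a \<noteq> c" "\<sigma> a = \<sigma> c" "step P (OutA a b) P1" "step P1 (InA c b) P2"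
        "P' = subst \<sigma> P2"
    | (alias_bound) a c P1 P2 where "a \<noteq> c" "c \<noteq> z" "\<sigma> a = \<sigma> c" "step P (BOutA a z) P1"
        "step P1 (InA c z) P2" "floats P' (subst (lift \<sigma>) (subst (bind z) P2))"
    by auto
  then show ?thesis
  proof cases
    case tau
    then have "step (Par P Q) TauA (Par P0 Q)" by (auto intro: step.parL)
    with tau TauA show ?thesis by (auto intro!: pre_step_tau simp del: pre_step.simps)
  next
    case aliased
    then have "step (Par P Q) (OutA a b) (Par P1 Q)" "step (Par P1 Q) (InA c b) (Par P2 Q)"
      by (auto intro: step.parL)
    with aliased(1,2) show ?thesis unfolding TauA by (rule pre_step_alias) (simp add: aliased(5))
  next
    case alias_bound
    then have "step (Par P Q) (BOutA a z) (Par P1 Q)" "step (Par P1 Q) (InA c z) (Par P2 Q)"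
      using assms(2) by (auto intro: step.parL)
    moreover have "floats (Par P' (subst \<sigma> Q)) (subst (lift \<sigma>) (subst (bind z) (Par P2 Q)))"
      using floats.parL[OF alias_bound(6)] assms(2) by (simp add: subst_lift_bind_fresh)
    ultimately show ?thesis using alias_bound(1-3) unfolding TauA by (intro pre_step_alias_bound)
  qed
qed

lemma pre_step_parR:
  assumes "pre_step P \<sigma> z \<mu> P'" and "z \<notin> fn Q"
  shows "pre_step (Par Q P) \<sigma> z \<mu> (Par (subst \<sigma> Q) P')"
proof (cases \<mu>)
  case (OutA a b)
  then show ?thesis using assms step.parR[of P "OutA _ _" _ Q] by fastforce
next
  case (BOutA a b)
  then show ?thesis using assms step.parR[of P "BOutA _ z" _ Q] by (fastforce simp: subst_fresh_upd)
next
  case (InA a b)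
  then show ?thesis using assms step.parR[of P "InA _ _" _ Q] by (fastforce simp: subst_fresh_upd)
next
  case TauA
  with assms(1) consider
      (tau) P0 where "step P TauA P0" "P' = subst \<sigma> P0"
    | (aliased) a b c P1 P2 where "a \<noteq> c" "\<sigma> a = \<sigma> c" "step P (OutA a b) P1" "step P1 (InA c b) P2"
        "P' = subst \<sigma> P2"
    | (alias_bound) a c P1 P2 where "a \<noteq> c" "c \<noteq> z" "\<sigma> a = \<sigma> c" "step P (BOutA a z) P1"
        "step P1 (InA c z) P2" "floats P' (subst (lift \<sigma>) (subst (bind z) P2))"
    by auto
  then show ?thesis
  proof cases
    case tau
    then have "step (Par Q P) TauA (Par Q P0)" by (auto intro: step.parR)
    with tau TauA show ?thesis by (auto intro!: pre_step_tau simp del: pre_step.simps)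
  next
    case aliased
    then have "step (Par Q P) (OutA a b) (Par Q P1)" "step (Par Q P1) (InA c b) (Par Q P2)"
      by (auto intro: step.parR)
    with aliased(1,2) show ?thesis unfolding TauA by (rule pre_step_alias) (simp add: aliased(5))
  next
    case alias_bound
    then have "step (Par Q P) (BOutA a z) (Par Q P1)" "step (Par Q P1) (InA c z) (Par Q P2)"
      using assms(2) by (auto intro: step.parR)
    moreover have "floats (Par (subst \<sigma> Q) P') (subst (lift \<sigma>) (subst (bind z) (Par Q P2)))"
      using floats.parR[OF alias_bound(6)] assms(2) by (simp add: subst_lift_bind_fresh)
    ultimately show ?thesis using alias_bound(1-3) unfolding TauA by (intro pre_step_alias_bound)
  qed
qed

lemma subst_upd_upd: "subst (\<sigma>(z := \<sigma> b)) P = subst \<sigma> (subst (id(z := b)) P)"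
  by (auto simp: subst_subst intro!: subst_cong_fn)

text \<open>An early input of a fresh name determines the inputs of all names on the same subject.
  This is why \<open>pre_step\<close> may record inputs with the single name
  \<open>z\<close>.\<close>

lemma step_In_rename:
  assumes "step P (InA a z) P'" and "z \<notin> fn P"
  shows "step P (InA a b) (subst (id(z := b)) P')"
proof -
  have "subst (id(z := b)) P = P" using assms(2) by (simp add: subst_fresh_upd)
  moreover have "a \<noteq> z" using assms step_In_fn by blast
  ultimately show ?thesis using step_subst[OF assms(1), of "id(z := b)"] by simp
qed

text \<open>If the two original subjects coincide, the communication exists before the substitution.
  Otherwise \<open>\<sigma>\<close> has identified them, and the two components move one after the
  other, the output before the input.\<close>

lemma pre_step_comm:
  assumes "pre_step P \<sigma> z (InA a b) P'" and "pre_step Q \<sigma> z (OutA a b) Q'" and "z \<notin> fn P \<union> fn Q"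
  shows "pre_step (Par P Q) \<sigma> z TauA (Par P' Q')" "pre_step (Par Q P) \<sigma> z TauA (Par Q' P')"
proof -
  obtain a1 P1 where P1: "step P (InA a1 z) P1" "\<sigma> a1 = a" "P' = subst (\<sigma>(z := b)) P1"
    using assms(1) by auto
  obtain a0 b0 Q1 where Q1: "step Q (OutA a0 b0) Q1" "\<sigma> a0 = a" "\<sigma> b0 = b" "Q' = subst \<sigma> Q1"
    using assms(2) by auto
  define P2 where "P2 = subst (id(z := b0)) P1"
  have P2: "step P (InA a1 b0) P2" "P' = subst \<sigma> P2"
    using step_In_rename[OF P1(1)] assms(3) P1(3) Q1(3) subst_upd_upd[of \<sigma> z b0 P1]
    by (auto simp: P2_def simp del: fun_upd_apply)
  show "pre_step (Par P Q) \<sigma> z TauA (Par P' Q')"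
  proof (cases "a0 = a1")
    case True
    then have "step (Par P Q) TauA (Par P2 Q1)" using P2 Q1 step.commL by blast
    then show ?thesis by (rule pre_step_tau) (simp add: P2 Q1)
  next
    case False
    have "step (Par P Q) (OutA a0 b0) (Par P Q1)" "step (Par P Q1) (InA a1 b0) (Par P2 Q1)"
      using P2 Q1 by (auto intro: step.parL step.parR)
    then show ?thesis by (rule pre_step_alias[rotated 2]) (use False P1 P2 Q1 in auto)
  qed
  show "pre_step (Par Q P) \<sigma> z TauA (Par Q' P')"
  proof (cases "a0 = a1")
    case True
    then have "step (Par Q P) TauA (Par Q1 P2)" using P2 Q1 step.commR by blast
    then show ?thesis by (rule pre_step_tau) (simp add: P2 Q1)
  next
    case False
    have "step (Par Q P) (OutA a0 b0) (Par Q1 P)" "step (Par Q1 P) (InA a1 b0) (Par Q1 P2)"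
      using P2 Q1 by (auto intro: step.parL step.parR)
    then show ?thesis by (rule pre_step_alias[rotated 2]) (use False P1 P2 Q1 in auto)
  qed
qed

lemma pre_step_close:
  assumes "pre_step P \<sigma> z (InA a b) P'" and "pre_step Q \<sigma> z (BOutA a b) Q'" and "z \<notin> fn P \<union> fn Q"
    and "b \<notin> \<sigma> ` (fn P \<union> fn Q)"
  shows "pre_step (Par P Q) \<sigma> z TauA (nu b (Par P' Q'))" "pre_step (Par Q P) \<sigma> z TauA (nu b (Par Q' P'))"
proof -
  obtain a1 P1 where P1: "step P (InA a1 z) P1" "\<sigma> a1 = a" "P' = subst (\<sigma>(z := b)) P1"
    using assms(1) by auto
  obtain a0 Q1 where Q1: "step Q (BOutA a0 z) Q1" "\<sigma> a0 = a" "Q' = subst (\<sigma>(z := b)) Q1"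
    using assms(2) by auto
  have "a1 \<in> fn P" "fn P1 \<union> fn Q1 \<subseteq> insert z (fn P \<union> fn Q)"
    using step_In_fn[OF P1(1)] step_BOut_fn[OF Q1(1)] by auto
  then have a1: "a1 \<noteq> z" and b: "b \<notin> \<sigma> ` (fn P1 \<union> fn Q1 - {z})" using assms(3,4) by auto
  \<comment> \<open>The binder is called \<open>b\<close> in the substituted process and
    \<open>z\<close> in the original one; freshness of \<open>b\<close> makes this a mere
    alpha-conversion.\<close>
  have eq: "nu b (Par P' Q') = subst \<sigma> (nu z (Par P1 Q1))"
    "nu b (Par Q' P') = subst \<sigma> (nu z (Par Q1 P1))"
    using b P1 Q1 by (subst subst_nu_rename[where z = b]; force)+
  show "pre_step (Par P Q) \<sigma> z TauA (nu b (Par P' Q'))"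
  proof (cases "a0 = a1")
    case True
    then have "step (Par P Q) TauA (nu z (Par P1 Q1))" using P1 Q1 assms(3) by (auto intro: step.closeL)
    then show ?thesis by (rule pre_step_tau) (rule eq)
  next
    case False
    have "step (Par P Q) (BOutA a0 z) (Par P Q1)" "step (Par P Q1) (InA a1 z) (Par P1 Q1)"
      using P1 Q1 assms(3) by (auto intro: step.parL step.parR)
    moreover have "floats (nu b (Par P' Q')) (subst (lift \<sigma>) (subst (bind z) (Par P1 Q1)))"
      unfolding eq by (simp add: nu_def floats.top)
    ultimately show ?thesis using False P1(2) Q1(2) a1
      by (intro pre_step_alias_bound[of a0 a1]) auto
  qed
  show "pre_step (Par Q P) \<sigma> z TauA (nu b (Par Q' P'))"
  proof (cases "a0 = a1")
    case True
    then have "step (Par Q P) TauA (nu z (Par Q1 P1))" using P1 Q1 assms(3) by (auto intro: step.closeR)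
    then show ?thesis by (rule pre_step_tau) (rule eq)
  next
    case False
    have "step (Par Q P) (BOutA a0 z) (Par Q1 P)" "step (Par Q1 P) (InA a1 z) (Par Q1 P1)"
      using P1 Q1 assms(3) by (auto intro: step.parL step.parR)
    moreover have "floats (nu b (Par Q' P')) (subst (lift \<sigma>) (subst (bind z) (Par Q1 P1)))"
      unfolding eq by (simp add: nu_def floats.top)
    ultimately show ?thesis using False P1(2) Q1(2) a1
      by (intro pre_step_alias_bound[of a0 a1]) auto
  qed
qed

lemma nu_subst_case_nat:
  assumes "\<And>n. n \<in> fn (Nu P) \<Longrightarrow> \<sigma> n \<noteq> a"
  shows "nu a (subst (case_nat a \<sigma>) P) = subst \<sigma> (Nu P)"
proof -
  have "subst (bind a \<circ> case_nat a \<sigma>) P = subst (lift \<sigma>) P"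
    by (rule subst_cong_fn) (use assms in \<open>auto simp: lift_def split: nat.split\<close>)
  then show ?thesis by (simp add: nu_def subst_subst)
qed

text \<open>When the binder is named \<open>a\<close>, the substitution acting on its body is
  \<open>case_nat a \<sigma>\<close>, and the reserved name \<open>z\<close> becomes
  \<open>Suc z\<close> there. A transition of the body is turned into one of the restriction case by
  case; the only change of kind is a plain aliased communication that becomes a bound one.\<close>

lemma pre_step_Nu:
  assumes "pre_step P (case_nat a \<sigma>) (Suc z) \<mu> P'" and a: "\<And>n. n \<in> fn (Nu P) \<Longrightarrow> \<sigma> n \<noteq> a"
    and "a \<notin> names \<mu>" and z: "z \<notin> fn (Nu P)"
  shows "pre_step (Nu P) \<sigma> z \<mu> (nu a P')"
proof -
  have upd: "(case_nat a \<sigma>)(Suc z := b) = case_nat a (\<sigma>(z := b))" for b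
    by (auto simp: fun_eq_iff split: nat.split)
  show ?thesis
  proof (cases \<mu>)
    case (OutA c b)
    then obtain c0 b0 P0 where P0: "step P (OutA c0 b0) P0" "case_nat a \<sigma> c0 = c"
        "case_nat a \<sigma> b0 = b" "P' = subst (case_nat a \<sigma>) P0"
      using assms(1) by auto
    with OutA assms(3) obtain c1 b1 where Suc: "c0 = Suc c1" "b0 = Suc b1"
      by (auto split: nat.split_asm)
    have "step (Nu P) (OutA c1 b1) (Nu P0)" using P0 Suc by (intro step_Nu_res) simp
    moreover have "nu a P' = subst \<sigma> (Nu P0)"
      unfolding P0(4) by (rule nu_subst_case_nat) (use a step_Out_fn[OF P0(1)] in auto)
    ultimately show ?thesis using P0(2,3) Suc unfolding OutA pre_step.simps
      by (intro exI[of _ c1] exI[of _ b1] exI[of _ "Nu P0"] conjI) simp_all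
  next
    case (BOutA c b)
    then obtain c0 P0 where P0: "step P (BOutA c0 (Suc z)) P0" "case_nat a \<sigma> c0 = c"
        "P' = subst (case_nat a (\<sigma>(z := b))) P0"
      using assms(1) by (auto simp: upd simp del: fun_upd_apply)
    with BOutA assms(3) obtain c1 where Suc: "c0 = Suc c1"
      by (auto split: nat.split_asm)
    have "step (Nu P) (BOutA c1 z) (Nu P0)" using P0 Suc by (intro step_Nu_res) simp
    moreover have "nu a P' = subst (\<sigma>(z := b)) (Nu P0)"
      unfolding P0(3) by (rule nu_subst_case_nat)
        (use a BOutA assms(3) step_BOut_fn[OF P0(1)] in auto)
    ultimately show ?thesis using P0(2) Suc unfolding BOutA pre_step.simps
      by (intro exI[of _ c1] exI[of _ "Nu P0"] conjI) simp_all
  next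
    case (InA c b)
    then obtain c0 P0 where P0: "step P (InA c0 (Suc z)) P0" "case_nat a \<sigma> c0 = c"
        "P' = subst (case_nat a (\<sigma>(z := b))) P0"
      using assms(1) by (auto simp: upd simp del: fun_upd_apply)
    with InA assms(3) obtain c1 where Suc: "c0 = Suc c1"
      by (auto split: nat.split_asm)
    have "step (Nu P) (InA c1 z) (Nu P0)" using P0 Suc by (intro step_Nu_res) simp
    moreover have "nu a P' = subst (\<sigma>(z := b)) (Nu P0)"
      unfolding P0(3) by (rule nu_subst_case_nat)
        (use a InA assms(3) step_In_fn[OF P0(1)] in auto)
    ultimately show ?thesis using P0(2) Suc unfolding InA pre_step.simps
      by (intro exI[of _ c1] exI[of _ "Nu P0"] conjI) simp_all
  next
    case TauA
    \<comment> \<open>A restricted name is never aliased: \<open>\<sigma>\<close> sends no free name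
      of the restriction to \<open>a\<close>, so index 0 is not identified with any other name of
      \<open>P\<close>.\<close>
    have sub: "c0 \<noteq> 0 \<and> d0 \<noteq> 0"
      if "c0 \<noteq> d0" "case_nat a \<sigma> c0 = case_nat a \<sigma> d0" "c0 \<in> fn P" "d0 \<in> fn P" for c0 d0
      using that a by (cases c0; cases d0) force+
    from TauA assms(1) consider
        (tau) P0 where "step P TauA P0" "P' = subst (case_nat a \<sigma>) P0"
      | (aliased) c b d P1 P2 where "c \<noteq> d" "case_nat a \<sigma> c = case_nat a \<sigma> d" "step P (OutA c b) P1"
          "step P1 (InA d b) P2" "P' = subst (case_nat a \<sigma>) P2"
      | (alias_bound) c d P1 P2 where "c \<noteq> d" "d \<noteq> Suc z" "case_nat a \<sigma> c = case_nat a \<sigma> d"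
          "step P (BOutA c (Suc z)) P1" "step P1 (InA d (Suc z)) P2"
          "floats P' (subst (lift (case_nat a \<sigma>)) (subst (bind (Suc z)) P2))"
      by auto
    then show ?thesis
    proof cases
      case tau
      have "nu a P' = subst \<sigma> (Nu P0)"
        unfolding tau(2) by (rule nu_subst_case_nat) (use a step_Tau_fn[OF tau(1)] in auto)
      moreover have "step (Nu P) TauA (Nu P0)" using tau by (intro step_Nu_res) simp
      ultimately show ?thesis unfolding TauA by (intro pre_step_tau)
    next
      case aliased
      have fn: "c \<in> fn P" "b \<in> fn P" "d \<in> fn P" "fn P1 \<subseteq> fn P" "fn P2 \<subseteq> fn P"
        using step_Out_fn[OF aliased(3)] step_In_fn[OF aliased(4)] by auto
      obtain c1 d1 where Suc: "c = Suc c1" "d = Suc d1"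
        using sub[OF aliased(1,2)] fn by (metis not0_implies_Suc)
      have nu: "nu a P' = subst \<sigma> (Nu P2)"
        unfolding aliased(5) by (rule nu_subst_case_nat) (use a fn in auto)
      show ?thesis
      proof (cases b)
        case 0
        \<comment> \<open>The transmitted name is the restricted one. Seen from outside, the output
          extrudes it as \<open>z\<close>, and the restriction left behind is already on
          top.\<close>
        have "step (Nu P) (BOutA c1 z) (subst (case_nat z id) P1)"
          using aliased 0 Suc z by (intro step_Nu_open) auto
        moreover have "step (subst (case_nat z id) P1) (InA d1 z) (subst (case_nat z id) P2)"
          using step_subst[OF aliased(4), of "case_nat z id"] 0 Suc by simp
        moreover have "z \<notin> fn (Nu P2)" using z fn by auto
        then have "floats (nu a P') (subst (lift \<sigma>) (subst (bind z) (subst (case_nat z id) P2)))"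
          using floats.top[of "subst (lift \<sigma>) P2"] unfolding nu
          by (simp add: subst_bind_case_nat)
        moreover have "d1 \<noteq> z" using z fn Suc by auto
        ultimately show ?thesis using aliased(1,2) Suc unfolding TauA
          by (intro pre_step_alias_bound[of c1 d1]) auto
      next
        case b: (Suc b1)
        have "step (Nu P) (OutA c1 b1) (Nu P1)" "step (Nu P1) (InA d1 b1) (Nu P2)"
          using aliased Suc b by (auto intro!: step_Nu_res)
        then show ?thesis unfolding TauA
          by (rule pre_step_alias[rotated 2]) (use aliased(1,2) Suc nu in auto)
      qed
    next
      case alias_bound
      have fn: "c \<in> fn P" "d \<in> fn P" "fn P1 \<subseteq> insert (Suc z) (fn P)" "fn P2 \<subseteq> insert (Suc z) (fn P)"
        using step_BOut_fn[OF alias_bound(4)] step_In_fn[OF alias_bound(5)] alias_bound(2) by auto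
      obtain c1 d1 where Suc: "c = Suc c1" "d = Suc d1"
        using sub[OF alias_bound(1,3)] fn by (metis not0_implies_Suc)
      have "step (Nu P) (BOutA c1 z) (Nu P1)" "step (Nu P1) (InA d1 z) (Nu P2)"
        using alias_bound Suc by (auto intro!: step_Nu_res)
      moreover have "floats (nu a P') (subst (lift \<sigma>) (subst (bind z) (Nu P2)))"
      proof -
        have "subst (bind (Suc a) \<circ> lift (case_nat a \<sigma>) \<circ> bind (Suc z)) P2 =
            subst (lift (lift \<sigma>) \<circ> lift (bind z)) P2"
        proof (rule subst_cong_fn(1), rule ballI)
          fix x assume "x \<in> fn P2"
          then have "x = 0 \<or> x = Suc z \<or> (\<exists>n. x = Suc n \<and> n \<noteq> z \<and> \<sigma> n \<noteq> a)"
            using fn a by (cases x) auto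
          then show "(bind (Suc a) \<circ> lift (case_nat a \<sigma>) \<circ> bind (Suc z)) x =
              (lift (lift \<sigma>) \<circ> lift (bind z)) x"
            by (auto simp: bind_def)
        qed
        then show ?thesis using floats_nu[OF alias_bound(6), of a]
          by (simp add: nu_def subst_subst comp_assoc)
      qed
      ultimately show ?thesis using alias_bound(1-3) Suc unfolding TauA
        by (intro pre_step_alias_bound[of c1 d1]) auto
    qed
  qed
qed

lemma subst_eqE:
  "Bang H = subst \<sigma> P \<Longrightarrow> \<exists>G. P = Bang G \<and> H = gsubst \<sigma> G"
  "Par X Y = subst \<sigma> P \<Longrightarrow> \<exists>Q R. P = Par Q R \<and> X = subst \<sigma> Q \<and> Y = subst \<sigma> R"
  "Nu X = subst \<sigma> P \<Longrightarrow> \<exists>Q. P = Nu Q \<and> X = subst (lift \<sigma>) Q"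
  "Grd H = subst \<sigma> P \<Longrightarrow> \<exists>G. P = Grd G \<and> H = gsubst \<sigma> G"
  "Out a b X = gsubst \<sigma> G \<Longrightarrow> \<exists>a0 b0 Q. G = Out a0 b0 Q \<and> a = \<sigma> a0 \<and> b = \<sigma> b0 \<and> X = subst \<sigma> Q"
  "Inp a X = gsubst \<sigma> G \<Longrightarrow> \<exists>a0 Q. G = Inp a0 Q \<and> a = \<sigma> a0 \<and> X = subst (lift \<sigma>) Q"
  "Tau X = gsubst \<sigma> G \<Longrightarrow> \<exists>Q. G = Tau Q \<and> X = subst \<sigma> Q"
  "Sum H K = gsubst \<sigma> G \<Longrightarrow> \<exists>H0 K0. G = Sum H0 K0 \<and> H = gsubst \<sigma> H0 \<and> K = gsubst \<sigma> K0"
  by (cases P; cases G; simp)+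

lemma nu_eq_subst:
  assumes "nu a X = subst \<sigma> P"
  obtains Q where "P = Nu Q" "X = subst (case_nat a \<sigma>) Q" "\<And>n. n \<in> fn (Nu Q) \<Longrightarrow> \<sigma> n \<noteq> a"
proof -
  obtain Q where Q: "P = Nu Q" "subst (bind a) X = subst (lift \<sigma>) Q"
    using assms subst_eqE(3) unfolding nu_def by blast
  have "X = subst (case_nat a id) (subst (lift \<sigma>) Q)" using Q(2)[symmetric] by simp
  moreover have "case_nat a id \<circ> lift \<sigma> = case_nat a \<sigma>"
    by (auto simp: lift_def split: nat.split)
  ultimately have "X = subst (case_nat a \<sigma>) Q" by (simp add: subst_subst)
  moreover have "a \<notin> \<sigma> ` fn P" using assms fn_nu[of a X] fn_subst(1)[of \<sigma> P] by auto
  ultimately show thesis using that Q(1) by blast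
qed

text \<open>The induction follows the derivation, not the process, since the rule \<open>rep\<close>
  unfolds the latter. Both \<open>\<sigma>\<close> and \<open>z\<close> vary because passing a
  binder changes them to \<open>case_nat a \<sigma>\<close> and \<open>Suc z\<close>.\<close>

lemma step_subst_cases:
  assumes "step (subst \<sigma> P) \<mu> P'" and "z \<notin> fn P"
  shows "pre_step P \<sigma> z \<mu> P'"
  using assms
proof (induction "subst \<sigma> P" \<mu> P' arbitrary: \<sigma> z P rule: step.induct)
  case (inp a b X c)
  then obtain a0 Q where Q: "P = Grd (Inp a0 Q)" "a = \<sigma> a0" "subst (bind b) X = subst (lift \<sigma>) Q"
    unfolding inp_def by (metis subst_eqE(4,6))
  have "id(b := c) = case_nat c id \<circ> bind b" by (auto simp: bind_def)
  then have "subst (id(b := c)) X = subst (case_nat c id) (subst (lift \<sigma>) Q)"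
    using Q(3) by (metis subst_subst(1))
  also have "\<dots> = subst (\<sigma>(z := c)) (subst (case_nat z id) Q)"
    unfolding subst_subst
    by (rule subst_cong_fn) (use inp Q in \<open>auto simp: lift_def split: nat.split\<close>)
  finally show ?case using step_Inp[of a0 Q z] Q by auto
next
  case (out a b X)
  then obtain a0 b0 Q where "P = Grd (Out a0 b0 Q)" "a = \<sigma> a0" "b = \<sigma> b0" "X = subst \<sigma> Q"
    by (metis subst_eqE(4,5))
  then show ?case using step.out[of a0 b0 Q] by auto
next
  case (tau X)
  then obtain Q where "P = Grd (Tau Q)" "X = subst \<sigma> Q"
    by (metis subst_eqE(4,7))
  then show ?case using step.tau[of Q] by auto
next
  case (rep H \<mu> P')
  then obtain G where G: "P = Bang G" "H = gsubst \<sigma> G" using subst_eqE(1) by blast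
  have "pre_step (Par (Bang G) (Grd G)) \<sigma> z \<mu> P'" by (rule rep) (use G rep in simp_all)
  then show ?case unfolding G(1) by (rule pre_step_mono) (rule step.rep)
next
  case (sumL H \<mu> P' K)
  then obtain H0 K0 where G: "P = Grd (Sum H0 K0)" "H = gsubst \<sigma> H0" by (metis subst_eqE(4,8))
  have "pre_step (Grd H0) \<sigma> z \<mu> P'" by (rule sumL) (use G sumL in simp_all)
  then show ?case unfolding G(1) by (rule pre_step_mono) (rule step.sumL)
next
  case (sumR H \<mu> P' K)
  then obtain H0 K0 where G: "P = Grd (Sum K0 H0)" "H = gsubst \<sigma> H0" by (metis subst_eqE(4,8))
  have "pre_step (Grd H0) \<sigma> z \<mu> P'" by (rule sumR) (use G sumR in simp_all)
  then show ?case unfolding G(1) by (rule pre_step_mono) (rule step.sumR)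
next
  case op: ("open" X a b X')
  from op(4) obtain Q where Q: "P = Nu Q" "X = subst (case_nat b \<sigma>) Q"
      "\<And>n. n \<in> fn (Nu Q) \<Longrightarrow> \<sigma> n \<noteq> b"
    by (rule nu_eq_subst) blast
  have "pre_step Q (case_nat b \<sigma>) (Suc z) (OutA a b) X'" by (rule op) (use Q op in simp_all)
  then obtain a0 b0 Q0 where Q0: "step Q (OutA a0 b0) Q0" "case_nat b \<sigma> a0 = a"
      "case_nat b \<sigma> b0 = b" "X' = subst (case_nat b \<sigma>) Q0"
    by auto
  have fn: "b0 \<in> fn Q" "fn Q0 \<subseteq> fn Q" using step_Out_fn[OF Q0(1)] by auto
  obtain a1 where a1: "a0 = Suc a1" using Q0(2) op(3) by (cases a0) auto
  \<comment> \<open>Among the free names of \<open>Q\<close> only index 0 is mapped to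
    \<open>b\<close>, so the extruded name is the restricted one and not another name sent there by
    \<open>\<sigma>\<close>.\<close>
  have b0: "b0 = 0" using Q0(3) fn Q(3) by (cases b0) auto
  have "step (Nu Q) (BOutA a1 z) (subst (case_nat z id) Q0)"
    using Q0 a1 b0 op Q by (intro step_Nu_open) auto
  moreover have "X' = subst (\<sigma>(z := b)) (subst (case_nat z id) Q0)"
    unfolding Q0(4) subst_subst
    by (rule subst_cong_fn) (use fn op Q in \<open>auto split: nat.split\<close>)
  ultimately show ?case using Q Q0 a1 by auto
next
  case (res X \<mu> X' a)
  from res(4) obtain Q where Q: "P = Nu Q" "X = subst (case_nat a \<sigma>) Q"
      "\<And>n. n \<in> fn (Nu Q) \<Longrightarrow> \<sigma> n \<noteq> a"
    by (rule nu_eq_subst) blast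
  have "pre_step Q (case_nat a \<sigma>) (Suc z) \<mu> X'" by (rule res) (use Q res in simp_all)
  then show ?case unfolding Q(1) by (rule pre_step_Nu) (use Q res in auto)
next
  case (parL X \<mu> X' Y)
  then obtain Q R where "P = Par Q R" "X = subst \<sigma> Q" "Y = subst \<sigma> R" using subst_eqE(2) by blast
  then show ?case using parL by (auto intro: pre_step_parL)
next
  case (parR X \<mu> X' Y)
  then obtain Q R where "P = Par R Q" "X = subst \<sigma> Q" "Y = subst \<sigma> R" using subst_eqE(2) by blast
  then show ?case using parR by (auto intro: pre_step_parR)
next
  case (commL X a b X' Y Y')
  then obtain Q R where "P = Par Q R" "X = subst \<sigma> Q" "Y = subst \<sigma> R" using subst_eqE(2) by blast
  then show ?case using commL by (auto intro!: pre_step_comm(1)[of Q \<sigma> z a b] simp del: pre_step.simps)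
next
  case (commR X a b X' Y Y')
  then obtain Q R where "P = Par R Q" "X = subst \<sigma> Q" "Y = subst \<sigma> R" using subst_eqE(2) by blast
  then show ?case using commR by (auto intro!: pre_step_comm(2)[of Q \<sigma> z a b] simp del: pre_step.simps)
next
  case (closeL X a b X' Y Y')
  then obtain Q R where QR: "P = Par Q R" "X = subst \<sigma> Q" "Y = subst \<sigma> R" using subst_eqE(2) by blast
  moreover have "b \<notin> \<sigma> ` (fn Q \<union> fn R)"
    using step_BOut_fn[OF closeL(3)] closeL(5) QR by (auto simp: fn_subst)
  ultimately show ?case using closeL
    by (auto intro!: pre_step_close(1)[of Q \<sigma> z a b] simp del: pre_step.simps)
next
  case (closeR X a b X' Y Y')
  then obtain Q R where QR: "P = Par R Q" "X = subst \<sigma> Q" "Y = subst \<sigma> R" using subst_eqE(2) by blast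
  moreover have "b \<notin> \<sigma> ` (fn Q \<union> fn R)"
    using step_BOut_fn[OF closeR(3)] closeR(5) QR by (auto simp: fn_subst)
  ultimately show ?case using closeR
    by (auto intro!: pre_step_close(2)[of Q \<sigma> z a b] simp del: pre_step.simps)
qed

section \<open>Expansion and weak transitions\<close>

lemma ss_mono: "R \<subseteq> S \<Longrightarrow> ss R \<subseteq> ss S"
  unfolding ss_def by blast

lemma ws_mono: "R \<subseteq> S \<Longrightarrow> ws R \<subseteq> ws S"
  unfolding ws_def by blast

lemma wsE:
  assumes "(P, Q) \<in> ws R" and "step P \<mu> P'" and "bn \<mu> \<inter> fn Q = {}"
  obtains Q' where "wstep_hat Q \<mu> Q'" "(P', Q') \<in> R"
  using assms unfolding ws_def by blast

lemma ssE:
  assumes "(P, Q) \<in> ss R" and "step P \<mu> P'" and "bn \<mu> \<inter> fn Q = {}"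
  obtains Q' where "step_hat Q \<mu> Q'" "(P', Q') \<in> R"
  using assms unfolding ss_def by blast

lemma expansion_ss: "expansion \<subseteq> ss expansion"
  and expansion_ws: "expansion\<inverse> \<subseteq> ws (expansion\<inverse>)"
proof -
  have "(P, Q) \<in> ss expansion \<and> (Q, P) \<in> ws (expansion\<inverse>)" if "(P, Q) \<in> expansion" for P Q
  proof -
    from that obtain R where R: "\<forall>(P, Q) \<in> R. (P, Q) \<in> ss R \<and> (Q, P) \<in> ws (R\<inverse>)" "(P, Q) \<in> R"
      unfolding expansion_def by blast
    then have "R \<subseteq> expansion" unfolding expansion_def by blast
    then show ?thesis using R ss_mono[of R expansion] ws_mono[of "R\<inverse>" "expansion\<inverse>"] by blast
  qed
  then show "expansion \<subseteq> ss expansion" "expansion\<inverse> \<subseteq> ws (expansion\<inverse>)" by auto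
qed

lemma wstep_hat_step: "step P \<mu> P' \<Longrightarrow> wstep_hat P \<mu> P'"
  unfolding wstep_hat_def wstep_def taus_def by (auto intro: r_into_rtranclp)

lemma strong_bisimulation_expansion:
  assumes "\<And>P Q \<mu> P'. (P, Q) \<in> R \<Longrightarrow> step P \<mu> P' \<Longrightarrow> \<exists>Q'. step Q \<mu> Q' \<and> (P', Q') \<in> R"
    and "\<And>P Q \<mu> Q'. (P, Q) \<in> R \<Longrightarrow> step Q \<mu> Q' \<Longrightarrow> \<exists>P'. step P \<mu> P' \<and> (P', Q') \<in> R"
  shows "R \<subseteq> expansion"
proof -
  have "R \<subseteq> ss R" using assms(1) unfolding ss_def step_hat_def by blast
  moreover have "R\<inverse> \<subseteq> ws (R\<inverse>)" using assms(2) wstep_hat_step unfolding ws_def by blast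
  ultimately show ?thesis unfolding expansion_def by blast
qed

lemma expansion_refl: "(P, P) \<in> expansion"
  using strong_bisimulation_expansion[of Id] by auto

lemma step_Bang_iff: "step (Bang G) \<mu> P' \<longleftrightarrow> step (Par (Bang G) (Grd G)) \<mu> P'"
proof
  show "step (Bang G) \<mu> P' \<Longrightarrow> step (Par (Bang G) (Grd G)) \<mu> P'"
    by (erule step.cases) (auto simp: nu_def)
qed (rule step.rep)

lemma expansion_Bang: "(Bang G, Par (Bang G) (Grd G)) \<in> expansion"
proof -
  have "Id \<union> {(Bang G, Par (Bang G) (Grd G))} \<subseteq> expansion"
    by (rule strong_bisimulation_expansion) (auto simp: step_Bang_iff)
  then show ?thesis by blast
qed

text \<open>Floating pairs form a strong bisimulation together with \<open>Id\<close>, which covers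
  the extrusion of the floating name: after it both sides are equal. Strong bisimulations are
  contained in expansion.\<close>

lemma expansion_floats: "floats A B \<Longrightarrow> (A, Nu B) \<in> expansion"
proof -
  have "Id \<union> {(A, Nu B) | A B. floats A B} \<subseteq> expansion"
  proof (rule strong_bisimulation_expansion)
    fix P Q \<mu> P'
    assume PQ: "(P, Q) \<in> Id \<union> {(A, Nu B) | A B. floats A B}" "step P \<mu> P'"
    show "\<exists>Q'. step Q \<mu> Q' \<and> (P', Q') \<in> Id \<union> {(A, Nu B) | A B. floats A B}"
    proof (cases "P = Q")
      case False
      with PQ obtain B where B: "Q = Nu B" "floats P B" by auto
      from floats_step[OF B(2) PQ(2)] show ?thesis
      proof (elim disjE exE conjE)
        fix B' assume "step B (act_subst Suc \<mu>) B'" "floats P' B'"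
        then show ?thesis using B step_Nu_res by blast
      next
        fix a b B' assume "\<mu> = BOutA a b" "b \<notin> fn P" "step B (OutA (Suc a) 0) B'" "P' = subst (case_nat b id) B'"
        then show ?thesis using B step_Nu_open[of B a B' b] floats_fn[OF B(2)] by auto
      qed
    qed (use PQ in auto)
  next
    fix P Q \<mu> Q'
    assume PQ: "(P, Q) \<in> Id \<union> {(A, Nu B) | A B. floats A B}" "step Q \<mu> Q'"
    show "\<exists>P'. step P \<mu> P' \<and> (P', Q') \<in> Id \<union> {(A, Nu B) | A B. floats A B}"
    proof (cases "P = Q")
      case False
      with PQ obtain B where B: "Q = Nu B" "floats P B" by auto
      from PQ(2) show ?thesis unfolding B(1)
      proof (cases rule: step_Nu_cases)
        case (res B')
        then show ?thesis using floats_step_inv(1)[OF B(2) res(1)] by blast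
      next
        case op: ("open" a b B')
        then show ?thesis using floats_step_inv(2)[OF B(2) op(3), of b] floats_fn[OF B(2)] by auto
      qed
    qed (use PQ in auto)
  qed
  moreover assume "floats A B"
  ultimately show ?thesis by blast
qed

section \<open>Weak transitions under the operators and along expansion\<close>

lemma taus_refl [simp]: "taus P P"
  unfolding taus_def by simp

lemma taus_trans [trans]: "taus P Q \<Longrightarrow> taus Q R \<Longrightarrow> taus P R"
  unfolding taus_def by (rule rtranclp_trans)

lemma step_taus: "step P TauA Q \<Longrightarrow> taus P Q"
  unfolding taus_def by (rule r_into_rtranclp)

lemma taus_map:
  assumes "taus P P'" and "\<And>P P'. step P TauA P' \<Longrightarrow> step (f P) TauA (f P')"
  shows "taus (f P) (f P')"
  using assms(1) unfolding taus_def
  by induction (auto intro: rtranclp.rtrancl_into_rtrancl assms(2))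

lemma taus_parL: "taus P P' \<Longrightarrow> taus (Par P Q) (Par P' Q)"
  by (erule taus_map) (auto intro: step.parL)

lemma taus_parR: "taus P P' \<Longrightarrow> taus (Par Q P) (Par Q P')"
  by (erule taus_map) (auto intro: step.parR)

lemma taus_par: "taus P P' \<Longrightarrow> taus Q Q' \<Longrightarrow> taus (Par P Q) (Par P' Q')"
  using taus_parL taus_parR taus_trans by blast

lemma taus_Nu: "taus P P' \<Longrightarrow> taus (Nu P) (Nu P')"
  by (erule taus_map) (auto intro: step_Nu_res)

lemma taus_subst: "taus P P' \<Longrightarrow> taus (subst \<sigma> P) (subst \<sigma> P')"
  by (erule taus_map) (use step_subst[of _ TauA] in auto)

lemma taus_nu: "taus P P' \<Longrightarrow> taus (nu b P) (nu b P')"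
  unfolding nu_def by (intro taus_Nu taus_subst)

lemma taus_fn: "taus P P' \<Longrightarrow> fn P' \<subseteq> fn P"
  unfolding taus_def by (induction rule: rtranclp_induct) (use step_Tau_fn in blast)+

lemma wstep_fn: "wstep P \<mu> P' \<Longrightarrow> fn P' \<subseteq> fn P \<union> names \<mu>"
  unfolding wstep_def using taus_fn step_fn by blast

lemma wstep_hat_fn: "wstep_hat P \<mu> P' \<Longrightarrow> fn P' \<subseteq> fn P \<union> names \<mu>"
  unfolding wstep_hat_def using taus_fn wstep_fn by (fastforce split: if_splits)

lemma wstep_hat_subst:
  assumes "wstep_hat P \<mu> P'" and "\<And>b. b \<in> bn \<mu> \<Longrightarrow> \<sigma> b \<notin> \<sigma> ` fn P"
  shows "wstep_hat (subst \<sigma> P) (act_subst \<sigma> \<mu>) (subst \<sigma> P')"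
proof (cases "\<mu> = TauA")
  case True
  then show ?thesis using assms taus_subst by (simp add: wstep_hat_def)
next
  case False
  then obtain P1 P2 where P: "taus P P1" "step P1 \<mu> P2" "taus P2 P'"
    using assms(1) by (auto simp: wstep_hat_def wstep_def)
  have "step (subst \<sigma> P1) (act_subst \<sigma> \<mu>) (subst \<sigma> P2)"
    by (rule step_subst[OF P(2)]) (use assms(2) taus_fn[OF P(1)] in blast)
  with P taus_subst have "wstep (subst \<sigma> P) (act_subst \<sigma> \<mu>) (subst \<sigma> P')"
    unfolding wstep_def by blast
  with False show ?thesis by (simp add: wstep_hat_def)
qed

lemma wstep_hat_map:
  assumes "wstep_hat P \<mu> P'" and "\<mu> = TauA \<longleftrightarrow> \<nu> = TauA"
    and "\<And>P P'. taus P P' \<Longrightarrow> taus (f P) (f P')" and "\<And>P P'. step P \<mu> P' \<Longrightarrow> step (f P) \<nu> (f P')"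
  shows "wstep_hat (f P) \<nu> (f P')"
proof (cases "\<mu> = TauA")
  case False
  then have "wstep (f P) \<nu> (f P')"
    using assms(1,3,4) unfolding wstep_hat_def wstep_def by (simp, blast)
  with False assms(2) show ?thesis by (simp add: wstep_hat_def)
qed (use assms(1-3) in \<open>simp add: wstep_hat_def\<close>)

lemma wstep_hat_parL:
  "wstep_hat P \<mu> P' \<Longrightarrow> bn \<mu> \<inter> fn Q = {} \<Longrightarrow> wstep_hat (Par P Q) \<mu> (Par P' Q)"
  by (erule wstep_hat_map) (auto intro: step.parL taus_parL)

lemma wstep_hat_parR:
  "wstep_hat P \<mu> P' \<Longrightarrow> bn \<mu> \<inter> fn Q = {} \<Longrightarrow> wstep_hat (Par Q P) \<mu> (Par Q P')"
  by (erule wstep_hat_map) (auto intro: step.parR taus_parR)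

lemma wstep_hat_Nu: "wstep_hat P (act_subst Suc \<mu>) P' \<Longrightarrow> wstep_hat (Nu P) \<mu> (Nu P')"
  by (erule wstep_hat_map) (auto intro: step_Nu_res taus_Nu)

lemma wstep_Nu_open:
  assumes "wstep P (OutA (Suc a) 0) P'" and "b \<notin> fn (Nu P)"
  shows "wstep (Nu P) (BOutA a b) (subst (case_nat b id) P')"
proof -
  obtain P1 P2 where P: "taus P P1" "step P1 (OutA (Suc a) 0) P2" "taus P2 P'"
    using assms(1) by (auto simp: wstep_def)
  then have "step (Nu P1) (BOutA a b) (subst (case_nat b id) P2)"
    using assms(2) taus_fn[OF P(1)] by (intro step_Nu_open) auto
  with P taus_Nu taus_subst show ?thesis unfolding wstep_def by blast
qed

lemma wstep_comm:
  assumes "wstep P (InA a b) P'" and "wstep Q (OutA a b) Q'"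
  shows "taus (Par P Q) (Par P' Q')" "taus (Par Q P) (Par Q' P')"
proof -
  obtain P1 P2 where P: "taus P P1" "step P1 (InA a b) P2" "taus P2 P'"
    using assms(1) by (auto simp: wstep_def)
  obtain Q1 Q2 where Q: "taus Q Q1" "step Q1 (OutA a b) Q2" "taus Q2 Q'"
    using assms(2) by (auto simp: wstep_def)
  have "taus (Par P1 Q1) (Par P2 Q2)" "taus (Par Q1 P1) (Par Q2 P2)"
    using P(2) Q(2) by (auto intro: step_taus step.commL step.commR)
  with taus_par[OF P(1) Q(1)] taus_par[OF Q(1) P(1)] taus_par[OF P(3) Q(3)] taus_par[OF Q(3) P(3)]
  show "taus (Par P Q) (Par P' Q')" "taus (Par Q P) (Par Q' P')"
    by (meson taus_trans)+
qed

lemma wstep_close: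
  assumes "wstep P (InA a b) P'" and "wstep Q (BOutA a b) Q'" and "b \<notin> fn P"
  shows "taus (Par P Q) (nu b (Par P' Q'))" "taus (Par Q P) (nu b (Par Q' P'))"
proof -
  obtain P1 P2 where P: "taus P P1" "step P1 (InA a b) P2" "taus P2 P'"
    using assms(1) by (auto simp: wstep_def)
  obtain Q1 Q2 where Q: "taus Q Q1" "step Q1 (BOutA a b) Q2" "taus Q2 Q'"
    using assms(2) by (auto simp: wstep_def)
  have "b \<notin> fn P1" using assms(3) taus_fn[OF P(1)] by blast
  then have "taus (Par P1 Q1) (nu b (Par P2 Q2))" "taus (Par Q1 P1) (nu b (Par Q2 P2))"
    using P(2) Q(2) by (auto intro: step_taus step.closeL step.closeR)
  with taus_par[OF P(1) Q(1)] taus_par[OF Q(1) P(1)]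
    taus_nu[OF taus_par[OF P(3) Q(3)]] taus_nu[OF taus_par[OF Q(3) P(3)]]
  show "taus (Par P Q) (nu b (Par P' Q'))" "taus (Par Q P) (nu b (Par Q' P'))"
    by (meson taus_trans)+
qed

text \<open>\<open>Bang G\<close> and its unfolding have the same first transitions, so they differ
  only in the empty weak transition, which stays at the unfolding.\<close>

lemma wstep_hat_Bang:
  assumes "wstep_hat (Par (Bang G) (Grd G)) \<mu> Q"
  shows "wstep_hat (Bang G) \<mu> Q \<or> \<mu> = TauA \<and> Q = Par (Bang G) (Grd G)"
proof -
  have taus: "taus (Bang G) X \<or> X = Par (Bang G) (Grd G)" if "taus (Par (Bang G) (Grd G)) X" for X
    using that unfolding taus_def
    by (cases rule: converse_rtranclpE) (auto simp: step_Bang_iff intro: converse_rtranclp_into_rtranclp)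
  show ?thesis
  proof (cases "\<mu> = TauA")
    case True
    then show ?thesis using assms taus by (auto simp: wstep_hat_def)
  next
    case False
    then obtain P1 P2 where P: "taus (Par (Bang G) (Grd G)) P1" "step P1 \<mu> P2" "taus P2 Q"
      using assms by (auto simp: wstep_hat_def wstep_def)
    then show ?thesis using False taus[OF P(1)] taus_refl step_Bang_iff
      unfolding wstep_hat_def wstep_def by metis
  qed
qed

lemma expansion_taus:
  assumes "taus Q1 Q1'" and "(Q, Q1) \<in> expansion"
  shows "\<exists>Q'. taus Q Q' \<and> (Q', Q1') \<in> expansion"
  using assms unfolding taus_def
proof (induction rule: rtranclp_induct)
  case (step Y Z)
  then obtain Q' where Q': "taus Q Q'" "(Q', Y) \<in> expansion" unfolding taus_def by blast
  then have "(Y, Q') \<in> ws (expansion\<inverse>)" using expansion_ws by blast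
  then obtain Q'' where "taus Q' Q''" "(Q'', Z) \<in> expansion"
    using wsE[of Y Q' "expansion\<inverse>" TauA Z] step(2) by (auto simp: wstep_hat_def)
  then show ?case using Q' taus_trans unfolding taus_def[symmetric] by blast
qed auto

text \<open>The slower side follows a weak transition step by step. Internal steps create no free
  names, so the bound name is still fresh when the visible step is reached.\<close>

lemma expansion_wstep_hat:
  assumes "wstep_hat Q1 \<mu> Q1'" and "(Q, Q1) \<in> expansion" and "bn \<mu> \<inter> fn Q = {}"
  shows "\<exists>Q'. wstep_hat Q \<mu> Q' \<and> (Q', Q1') \<in> expansion"
proof (cases "\<mu> = TauA")
  case True
  then show ?thesis using assms expansion_taus by (simp add: wstep_hat_def)
next
  case False
  then obtain Y Z where YZ: "taus Q1 Y" "step Y \<mu> Z" "taus Z Q1'"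
    using assms(1) by (auto simp: wstep_hat_def wstep_def)
  obtain Y' where Y': "taus Q Y'" "(Y', Y) \<in> expansion"
    using expansion_taus[OF YZ(1) assms(2)] by blast
  then have "(Y, Y') \<in> ws (expansion\<inverse>)" "bn \<mu> \<inter> fn Y' = {}"
    using expansion_ws assms(3) taus_fn[OF Y'(1)] by blast+
  then obtain Z' where Z': "wstep Y' \<mu> Z'" "(Z', Z) \<in> expansion"
    using wsE[of Y Y' "expansion\<inverse>" \<mu> Z] YZ(2) False by (auto simp: wstep_hat_def)
  obtain Q' where Q': "taus Z' Q'" "(Q', Q1') \<in> expansion"
    using expansion_taus[OF YZ(3) Z'(2)] by blast
  have "wstep Q \<mu> Q'" using Y'(1) Z'(1) Q'(1) taus_trans unfolding wstep_def by blast
  then show ?thesis using False Q'(2) by (auto simp: wstep_hat_def)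
qed

section \<open>The closure is a weak bisimulation\<close>

text \<open>
  Only substitution and input prefixes refer to the calculus, because the communication property
  is available for its members only. The other operators are not restricted to it: a communication of
  \<open>P\<close> and \<open>Q\<close> in \<open>C\<close> can lead to \<open>nu b (Par P' Q')\<close> in \<open>C\<close> with \<open>Par P' Q'\<close> outside \<open>C\<close>.
\<close>

inductive cl :: "proc set \<Rightarrow> proc rel \<Rightarrow> proc \<Rightarrow> proc \<Rightarrow> bool"
  and gcl :: "proc set \<Rightarrow> proc rel \<Rightarrow> gproc \<Rightarrow> gproc \<Rightarrow> bool"
  for C :: "proc set" and R :: "proc rel" where
  base: "(P, Q) \<in> R \<Longrightarrow> cl C R P Q"
| conv: "(P, Q) \<in> R \<Longrightarrow> cl C R Q P"
| refl: "cl C R P P"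
| exp: "(P, P1) \<in> expansion \<Longrightarrow> cl C R P1 Q1 \<Longrightarrow> (Q, Q1) \<in> expansion \<Longrightarrow> cl C R P Q"
| sub: "cl C R P Q \<Longrightarrow> inj_on \<sigma> (fn P \<union> fn Q) \<or> P \<in> C \<and> Q \<in> C \<Longrightarrow> cl C R (subst \<sigma> P) (subst \<sigma> Q)"
| res: "cl C R P Q \<Longrightarrow> cl C R (Nu P) (Nu Q)"
| par: "cl C R P Q \<Longrightarrow> cl C R P' Q' \<Longrightarrow> cl C R (Par P P') (Par Q Q')"
| rep: "cl C R (Grd G) (Grd G') \<Longrightarrow> cl C R (Bang G) (Bang G')"
| grd: "gcl C R G G' \<Longrightarrow> cl C R (Grd G) (Grd G')"
| gtau: "cl C R P Q \<Longrightarrow> gcl C R (Tau P) (Tau Q)"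
| gout: "cl C R P Q \<Longrightarrow> gcl C R (Out a b P) (Out a b Q)"
| ginp: "cl C R P Q \<Longrightarrow> P \<in> C \<Longrightarrow> Q \<in> C \<Longrightarrow> gcl C R (inp a b P) (inp a b Q)"
| grefl: "gcl C R G G"
| gsum: "gcl C R G G' \<Longrightarrow> gcl C R H H' \<Longrightarrow> gcl C R (Sum G H) (Sum G' H')"

lemma cl_sym: "cl C R P Q \<Longrightarrow> cl C R Q P" "gcl C R G G' \<Longrightarrow> gcl C R G' G"
proof (induction rule: cl_gcl.inducts)
  case (sub P Q \<sigma>)
  then show ?case by (auto intro!: cl_gcl.sub simp: Un_commute)
qed (auto intro: cl_gcl.intros)

text \<open>\<open>bind a\<close> is injective, so the substitution hidden in \<open>nu\<close> is a
  renaming and the pair may lie outside \<open>C\<close>.\<close>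

lemma cl_nu: "cl C R P Q \<Longrightarrow> cl C R (nu a P) (nu a Q)"
  unfolding nu_def by (intro cl_gcl.res cl_gcl.sub disjI1 inj_on_subset[OF inj_bind]) simp_all

lemma step_Inp_cases:
  "step (Grd (inp a b P)) \<mu> P' \<Longrightarrow> \<exists>c. \<mu> = InA a c \<and> P' = subst (id(b := c)) P"
proof (erule step.cases)
  fix a' b' Q c assume eq: "Grd (inp a b P) = Grd (inp a' b' Q)" "\<mu> = InA a' c" "P' = subst (id(b' := c)) Q"
  have id_upd: "subst (id(b := c)) P = subst (case_nat c id) (subst (bind b) P)" for b P
    by (auto simp: subst_subst bind_def intro!: subst_cong_fn)
  show ?thesis using eq by (auto simp: id_upd inp_def simp del: fun_upd_apply)
qed (auto simp: inp_def nu_def)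

text \<open>Guarded processes answer by a single step of the same kind, whatever their continuations
  do: firing a prefix exposes a pair of the closure. An input instantiates the continuations by a
  substitution that may identify names, which is where membership in \<open>C\<close> from
  \<open>ginp\<close> enters.\<close>

lemma gcl_step:
  "gcl C R G G' \<Longrightarrow> step (Grd G) \<mu> P' \<Longrightarrow> \<exists>Q'. step (Grd G') \<mu> Q' \<and> cl C R P' Q'"
proof (induction arbitrary: and \<mu> P' rule: cl_gcl.inducts(2)[where ?P1.0 = "\<lambda>_ _. True"])
  case (gtau P Q)
  from gtau(3) show ?case
    by (rule step.cases) (use gtau(1) in \<open>auto simp: inp_def nu_def intro: step.tau\<close>)
next
  case (gout P Q a b)
  from gout(3) show ?case
    by (rule step.cases) (use gout(1) in \<open>auto simp: inp_def nu_def intro: step.out\<close>)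
next
  case (ginp P Q a b)
  then obtain c where "\<mu> = InA a c" "P' = subst (id(b := c)) P" using step_Inp_cases by blast
  then show ?case using ginp cl_gcl.sub[of C R P Q "id(b := c)"] step.inp by blast
next
  case (gsum G G' H H')
  from gsum.prems show ?case
  proof cases
    case sumL
    then show ?thesis using gsum.IH(1) step.sumL by blast
  next
    case sumR
    then show ?thesis using gsum.IH(2) step.sumR by blast
  qed (auto simp: inp_def nu_def)
qed (auto intro: cl_gcl.refl)

lemma step_in_calculus: "calculus C \<Longrightarrow> P \<in> C \<Longrightarrow> step P \<mu> P' \<Longrightarrow> P' \<in> C"
  unfolding calculus_def by blast

lemma taus_in_calculus: "calculus C \<Longrightarrow> P \<in> C \<Longrightarrow> taus P P' \<Longrightarrow> P' \<in> C"
  unfolding taus_def by (rotate_tac 2) (induction rule: rtranclp_induct, auto dest: step_in_calculus)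

lemma wstep_in_calculus: "calculus C \<Longrightarrow> P \<in> C \<Longrightarrow> wstep P \<mu> P' \<Longrightarrow> P' \<in> C"
  unfolding wstep_def using taus_in_calculus step_in_calculus by blast

lemma wstep_hat_in_calculus: "calculus C \<Longrightarrow> P \<in> C \<Longrightarrow> wstep_hat P \<mu> P' \<Longrightarrow> P' \<in> C"
  unfolding wstep_hat_def by (metis taus_in_calculus wstep_in_calculus)

text \<open>
  The flag \<open>V\<close> allows one induction to serve both for visible actions (\<open>V = False\<close>) and, once these
  are settled for the whole closure, for \<open>\<tau>\<close> as well (\<open>V = True\<close>).
\<close>

definition matches :: "proc set \<Rightarrow> proc rel \<Rightarrow> bool \<Rightarrow> proc \<Rightarrow> proc \<Rightarrow> bool" where
  "matches C R V P Q \<longleftrightarrow> (\<forall>\<mu> P'. (\<mu> = TauA \<longrightarrow> V) \<longrightarrow> bn \<mu> \<inter> fn Q = {} \<longrightarrow> step P \<mu> P' \<longrightarrow>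
    (\<exists>Q'. wstep_hat Q \<mu> Q' \<and> cl C R P' Q'))"

lemma matchesE:
  assumes "matches C R V P Q" and "step P \<mu> P'" and "\<mu> = TauA \<Longrightarrow> V" and "bn \<mu> \<inter> fn Q = {}"
  obtains Q' where "wstep_hat Q \<mu> Q'" "cl C R P' Q'"
  using assms unfolding matches_def by blast

lemma matches_wstepE:
  assumes "matches C R V P Q" and "step P \<mu> P'" and "\<mu> \<noteq> TauA" and "bn \<mu> \<inter> fn Q = {}"
  obtains Q' where "wstep Q \<mu> Q'" "cl C R P' Q'"
  using assms unfolding matches_def wstep_hat_def by metis

section \<open>Each operator preserves the matching of transitions\<close>

lemma answer_rename:
  assumes "step P (BOutA a b) P'" and "b \<notin> fn Q" and "finite X"
    and answer: "\<And>z P'. z \<notin> X \<Longrightarrow> step P (BOutA a z) P' \<Longrightarrow> \<exists>Q'. wstep_hat Q (BOutA a z) Q' \<and> cl C R P' Q'"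
  shows "\<exists>Q'. wstep_hat Q (BOutA a b) Q' \<and> cl C R P' Q'"
proof -
  obtain z where z: "z \<notin> X \<union> fn P \<union> fn Q \<union> fn P' \<union> {a, b}"
    using ex_fresh_name[of "X \<union> fn P \<union> fn Q \<union> fn P' \<union> {a, b}"] assms(3) by auto
  have fr: "a \<noteq> b" "b \<notin> fn P" using step_BOut_fn[OF assms(1)] by auto
  let ?P = "subst (id(b := z)) P'"
  have "step P (BOutA a z) ?P"
  proof -
    have "step (subst (id(b := z)) P) (act_subst (id(b := z)) (BOutA a b)) ?P"
      by (rule step_subst[OF assms(1)]) (use z fr in auto)
    then show ?thesis using fr by (simp add: subst_fresh_upd)
  qed
  then obtain Q' where Q': "wstep_hat Q (BOutA a z) Q'" "cl C R ?P Q'" using answer z by blast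
  have "wstep_hat (subst (id(z := b)) Q) (act_subst (id(z := b)) (BOutA a z)) (subst (id(z := b)) Q')"
    by (rule wstep_hat_subst[OF Q'(1)]) (use assms(2) z in auto)
  then have "wstep_hat Q (BOutA a b) (subst (id(z := b)) Q')"
    using z by (simp add: subst_fresh_upd)
  moreover have "b \<notin> fn ?P \<union> fn Q'"
    using wstep_hat_fn[OF Q'(1)] assms(2) fr z by (auto simp: fn_subst)
  \<comment> \<open>Renaming back would merge \<open>z\<close> with \<open>b\<close> in general, but
    \<open>b\<close> occurs on neither side of the pair. Hence the closure applies without reference
    to \<open>C\<close>.\<close>
  then have "inj_on (id(z := b)) (fn ?P \<union> fn Q')" by (auto simp: inj_on_def)
  then have "cl C R (subst (id(z := b)) ?P) (subst (id(z := b)) Q')" using Q'(2) cl_gcl.sub by blast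
  moreover have "subst (id(z := b)) ?P = P'"
  proof -
    have "subst (id(z := b) \<circ> id(b := z)) P' = subst id P'"
      by (rule subst_cong_fn) (use z in auto)
    then show ?thesis by (simp add: subst_subst)
  qed
  ultimately show ?thesis by auto
qed

text \<open>The strict half of expansion lets \<open>P1\<close> answer by at most one step, so the
  hypothesis is applied to the pair \<open>P1\<close>, \<open>Q1\<close> itself and never to
  derivatives of a longer run. A bound name must also be fresh for \<open>P1\<close> and
  \<open>Q1\<close>, which \<open>answer_rename\<close> arranges.\<close>

lemma matches_exp:
  assumes "(P, P1) \<in> expansion" and "matches C R V P1 Q1" and "cl C R P1 Q1" and "(Q, Q1) \<in> expansion"
  shows "matches C R V P Q"
proof -
  have answer: "\<exists>Q'. wstep_hat Q \<mu> Q' \<and> cl C R P' Q'"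
    if st: "step P \<mu> P'" and V: "\<mu> = TauA \<Longrightarrow> V" and bn: "bn \<mu> \<inter> (fn Q \<union> fn P1 \<union> fn Q1) = {}" for \<mu> P'
  proof -
    have "(P, P1) \<in> ss expansion" using assms(1) expansion_ss by blast
    moreover have "bn \<mu> \<inter> fn P1 = {}" using bn by auto
    ultimately obtain P1' where P1': "step_hat P1 \<mu> P1'" "(P', P1') \<in> expansion"
      using ssE st by blast
    show ?thesis
    proof (cases "step P1 \<mu> P1'")
      case True
      have "bn \<mu> \<inter> fn Q1 = {}" "bn \<mu> \<inter> fn Q = {}" using bn by auto
      then obtain Q1' where Q1': "wstep_hat Q1 \<mu> Q1'" "cl C R P1' Q1'"
        using matchesE[OF assms(2) True V] by blast
      obtain Q' where "wstep_hat Q \<mu> Q'" "(Q', Q1') \<in> expansion"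
        using expansion_wstep_hat[OF Q1'(1) assms(4) \<open>bn \<mu> \<inter> fn Q = {}\<close>] by blast
      then show ?thesis using P1'(2) Q1'(2) cl_gcl.exp by blast
    next
      case False
      then have "\<mu> = TauA" "P1' = P1" using P1'(1) by (auto simp: step_hat_def)
      then have "wstep_hat Q \<mu> Q" "cl C R P' Q"
        using P1'(2) assms(3,4) cl_gcl.exp by (auto simp: wstep_hat_def)
      then show ?thesis by blast
    qed
  qed
  show ?thesis unfolding matches_def
  proof (intro allI impI)
    fix \<mu> P' assume \<mu>: "\<mu> = TauA \<longrightarrow> V" "bn \<mu> \<inter> fn Q = {}" "step P \<mu> P'"
    show "\<exists>Q'. wstep_hat Q \<mu> Q' \<and> cl C R P' Q'"
    proof (cases "\<exists>a b. \<mu> = BOutA a b")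
      case True
      then obtain a b where ab: "\<mu> = BOutA a b" by blast
      show ?thesis unfolding ab
        by (rule answer_rename[where X = "fn Q \<union> fn P1 \<union> fn Q1"])
          (use \<mu> ab in \<open>auto intro!: answer\<close>)
    next
      case False
      then have "bn \<mu> = {}" by (cases \<mu>) auto
      then show ?thesis using answer[of \<mu> P'] \<mu> by simp
    qed
  qed
qed

text \<open>The alternative on \<open>\<rho>\<close> passes to the derivatives: their free names
  come from the sources and the label, and \<open>C\<close> is closed under transitions.\<close>

lemma answer_subst:
  assumes "calculus C" and "matches C R V P Q" and "step P \<nu> P0" and "\<nu> = TauA \<Longrightarrow> V"
    and "bn \<nu> \<inter> fn Q = {}" and "\<And>b. b \<in> bn \<nu> \<Longrightarrow> \<rho> b \<notin> \<rho> ` fn Q"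
    and "inj_on \<rho> (fn P \<union> fn Q \<union> names \<nu>) \<or> P \<in> C \<and> Q \<in> C"
  shows "\<exists>Q'. wstep_hat (subst \<rho> Q) (act_subst \<rho> \<nu>) Q' \<and> cl C R (subst \<rho> P0) Q'"
proof -
  obtain Q0 where Q0: "wstep_hat Q \<nu> Q0" "cl C R P0 Q0"
    using matchesE[OF assms(2-5)] by blast
  have "fn P0 \<union> fn Q0 \<subseteq> fn P \<union> fn Q \<union> names \<nu>"
    using step_fn[OF assms(3)] wstep_hat_fn[OF Q0(1)] by auto
  then have "inj_on \<rho> (fn P0 \<union> fn Q0) \<or> P0 \<in> C \<and> Q0 \<in> C"
    using assms(7) step_in_calculus[OF assms(1) _ assms(3)] wstep_hat_in_calculus[OF assms(1) _ Q0(1)]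
    by (blast intro: inj_on_subset)
  then have "cl C R (subst \<rho> P0) (subst \<rho> Q0)" using Q0(2) cl_gcl.sub by blast
  moreover have "wstep_hat (subst \<rho> Q) (act_subst \<rho> \<nu>) (subst \<rho> Q0)"
    by (rule wstep_hat_subst[OF Q0(1)]) (rule assms(6))
  ultimately show ?thesis by blast
qed

text \<open>An aliased communication identifies two different free names of \<open>P\<close>. So
  \<open>\<sigma>\<close> is not injective there, both processes lie in \<open>C\<close>, and the
  communication property applies to \<open>Q\<close>.\<close>

lemma matches_sub:
  assumes "calculus C" and "weak_acp C" and "matches C R V P Q"
    and sub: "inj_on \<sigma> (fn P \<union> fn Q) \<or> P \<in> C \<and> Q \<in> C"
    and visible: "V \<Longrightarrow> \<forall>P Q. cl C R P Q \<longrightarrow> matches C R False P Q"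
    and "cl C R P Q"
  shows "matches C R V (subst \<sigma> P) (subst \<sigma> Q)"
  unfolding matches_def
proof (intro allI impI)
  fix \<mu> P' assume V: "\<mu> = TauA \<longrightarrow> V" and bn: "bn \<mu> \<inter> fn (subst \<sigma> Q) = {}" and st: "step (subst \<sigma> P) \<mu> P'"
  let ?F = "fn P \<union> fn Q"
  obtain z where z: "z \<notin> ?F \<union> \<sigma> ` ?F"
    using ex_fresh_name[of "?F \<union> \<sigma> ` ?F"] by auto
  have inj_upd: "inj_on (\<sigma>(z := b)) (insert z ?F) \<or> P \<in> C \<and> Q \<in> C" if "b \<notin> \<sigma> ` ?F" for b
    using sub that by (auto simp: inj_on_def image_iff)
  have upd: "subst (\<sigma>(z := b)) Q = subst \<sigma> Q" for b using z by (simp add: subst_fresh_upd)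
  have pre: "pre_step P \<sigma> z \<mu> P'" by (rule step_subst_cases[OF st]) (use z in simp)
  show "\<exists>Q'. wstep_hat (subst \<sigma> Q) \<mu> Q' \<and> cl C R P' Q'"
  proof (cases \<mu>)
    case (OutA a b)
    with pre obtain a0 b0 P0 where P0: "step P (OutA a0 b0) P0" "\<sigma> a0 = a" "\<sigma> b0 = b" "P' = subst \<sigma> P0"
      by auto
    have "fn P \<union> fn Q \<union> names (OutA a0 b0) = ?F" using step_Out_fn[OF P0(1)] by auto
    then show ?thesis using answer_subst[OF assms(1,3) P0(1), of \<sigma>] sub P0 OutA by simp
  next
    case (BOutA a b)
    with pre obtain a0 P0 where P0: "step P (BOutA a0 z) P0" "\<sigma> a0 = a" "P' = subst (\<sigma>(z := b)) P0"
      by auto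
    have a0: "a0 \<in> fn P" "a0 \<noteq> z" using step_BOut_fn[OF P0(1)] by auto
    then have names: "fn P \<union> fn Q \<union> names (BOutA a0 z) = insert z ?F" by auto
    have "b \<notin> \<sigma> ` ?F" using step_bn[OF st] bn BOutA by (auto simp: fn_subst)
    then have "\<exists>Q'. wstep_hat (subst (\<sigma>(z := b)) Q) (act_subst (\<sigma>(z := b)) (BOutA a0 z)) Q' \<and>
        cl C R (subst (\<sigma>(z := b)) P0) Q'"
      using inj_upd z by (intro answer_subst[OF assms(1,3) P0(1)]) (auto simp: names simp del: names.simps)
    then show ?thesis using P0 BOutA a0 by (simp add: upd)
  next
    case (InA a c)
    with pre obtain a0 P0 where P0: "step P (InA a0 z) P0" "\<sigma> a0 = a" "P' = subst (\<sigma>(z := c)) P0"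
      by auto
    have a0: "a0 \<in> fn P" "a0 \<noteq> z" using step_In_fn[OF P0(1)] z by auto
    show ?thesis
    proof (cases "c \<in> \<sigma> ` ?F")
      case True
      \<comment> \<open>Mapping \<open>z\<close> to a name already in the image could destroy
        injectivity; the input is replayed with a preimage \<open>c0\<close> of the received name
        instead.\<close>
      then obtain c0 where c0: "c0 \<in> ?F" "c = \<sigma> c0" by blast
      then have "fn P \<union> fn Q \<union> names (InA a0 c0) = ?F" using a0 by auto
      moreover have "step P (InA a0 c0) (subst (id(z := c0)) P0)"
        using step_In_rename[OF P0(1)] z by simp
      moreover have "P' = subst \<sigma> (subst (id(z := c0)) P0)"
        using P0(3) c0(2) by (simp add: subst_upd_upd)
      ultimately show ?thesis
        using answer_subst[OF assms(1,3), of "InA a0 c0" _ \<sigma>] sub P0(2) c0(2) InA by simp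
    next
      case False
      have names: "fn P \<union> fn Q \<union> names (InA a0 z) = insert z ?F" using a0 by auto
      have "\<exists>Q'. wstep_hat (subst (\<sigma>(z := c)) Q) (act_subst (\<sigma>(z := c)) (InA a0 z)) Q' \<and>
          cl C R (subst (\<sigma>(z := c)) P0) Q'"
        using inj_upd[OF False] by (intro answer_subst[OF assms(1,3) P0(1)]) (auto simp: names simp del: names.simps)
      then show ?thesis using P0 InA a0 by (simp add: upd)
    qed
  next
    case TauA
    with V have V and vis: "\<And>P Q. cl C R P Q \<Longrightarrow> matches C R False P Q" using visible by auto
    from TauA pre consider
        (tau) P0 where "step P TauA P0" "P' = subst \<sigma> P0"
      | (aliased) a b c P1 P2 where "a \<noteq> c" "\<sigma> a = \<sigma> c" "step P (OutA a b) P1" "step P1 (InA c b) P2"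
          "P' = subst \<sigma> P2"
      | (alias_bound) a c P1 P2 where "a \<noteq> c" "c \<noteq> z" "\<sigma> a = \<sigma> c" "step P (BOutA a z) P1"
          "step P1 (InA c z) P2" "floats P' (subst (lift \<sigma>) (subst (bind z) P2))"
      by auto
    then show ?thesis
    proof cases
      case tau
      then show ?thesis using answer_subst[OF assms(1,3) tau(1), of \<sigma>] sub TauA \<open>V\<close> by simp
    next
      case aliased
      have "a \<in> fn P" "c \<in> fn P" using step_Out_fn[OF aliased(3)] step_In_fn[OF aliased(4)] by auto
      then have PQ: "P \<in> C" "Q \<in> C" using sub aliased(1,2) by (auto dest: inj_onD)
      obtain Q1 where Q1: "wstep Q (OutA a b) Q1" "cl C R P1 Q1"
        using matches_wstepE[OF assms(3) aliased(3)] by auto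
      obtain Q2 where Q2: "wstep Q1 (InA c b) Q2" "cl C R P2 Q2"
        using matches_wstepE[OF vis[OF Q1(2)] aliased(4)] by auto
      have "taus (subst \<sigma> Q) (subst \<sigma> Q2)"
        using assms(2) PQ(2) Q1(1) Q2(1) aliased(2) unfolding weak_acp_def by blast
      moreover have "P2 \<in> C" using PQ(1) aliased(3,4) step_in_calculus[OF assms(1)] by blast
      moreover have "Q2 \<in> C" using PQ(2) Q1(1) Q2(1) wstep_in_calculus[OF assms(1)] by blast
      ultimately show ?thesis using Q2(2) cl_gcl.sub TauA aliased(5) by (auto simp: wstep_hat_def)
    next
      case alias_bound
      have fn: "a \<in> fn P" "c \<in> fn P" "fn P2 \<subseteq> insert z (fn P)"
        using step_BOut_fn[OF alias_bound(4)] step_In_fn[OF alias_bound(5)] alias_bound(2) by auto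
      then have PQ: "P \<in> C" "Q \<in> C" using sub alias_bound(1,3) by (auto dest: inj_onD)
      obtain Q1 where Q1: "wstep Q (BOutA a z) Q1" "cl C R P1 Q1"
        using matches_wstepE[OF assms(3) alias_bound(4)] z by auto
      obtain Q2 where Q2: "wstep Q1 (InA c z) Q2" "cl C R P2 Q2"
        using matches_wstepE[OF vis[OF Q1(2)] alias_bound(5)] by auto
      \<comment> \<open>The bound clause of the property wants a substitution that does not touch
        \<open>z\<close>, while \<open>\<sigma>\<close> may move it. \<open>\<rho>\<close> keeps
        \<open>\<sigma>\<close> on the free names of \<open>P\<close> and \<open>Q\<close>
        only.\<close>
      define \<rho> where "\<rho> x = (if x \<in> ?F then \<sigma> x else x)" for x
      have fresh: "fresh_for z \<rho>" using z by (auto simp: fresh_for_def \<rho>_def)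
      have "taus (subst \<rho> Q) (nu z (subst \<rho> Q2))"
        using assms(2) PQ(2) Q1(1) Q2(1) alias_bound(3) fresh fn(1,2)
        unfolding weak_acp_def by (auto simp: \<rho>_def)
      moreover have "subst \<rho> Q = subst \<sigma> Q" by (rule subst_cong_fn) (simp add: \<rho>_def)
      moreover have "P2 \<in> C" using PQ(1) alias_bound(4,5) step_in_calculus[OF assms(1)] by blast
      moreover have "Q2 \<in> C" using PQ(2) Q1(1) Q2(1) wstep_in_calculus[OF assms(1)] by blast
      ultimately have Q: "taus (subst \<sigma> Q) (nu z (subst \<rho> Q2))" "cl C R (nu z (subst \<rho> P2)) (nu z (subst \<rho> Q2))"
        using Q2(2) by (auto intro: cl_nu cl_gcl.sub)
      have "subst \<rho> (nu z P2) = subst \<sigma> (nu z P2)"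
        by (rule subst_cong_fn) (use fn(3) in \<open>auto simp: \<rho>_def fn_nu\<close>)
      then have "nu z (subst \<rho> P2) = Nu (subst (lift \<sigma>) (subst (bind z) P2))"
        using subst_nu[OF fresh, of P2] by (simp add: nu_def)
      then have "(P', nu z (subst \<rho> P2)) \<in> expansion"
        using expansion_floats[OF alias_bound(6)] by simp
      then have "cl C R P' (nu z (subst \<rho> Q2))" using Q(2) expansion_refl cl_gcl.exp by blast
      then show ?thesis using Q(1) TauA by (auto simp: wstep_hat_def)
    qed
  qed
qed

text \<open>Opening the restriction calls for the visible answer to an output of index 0. The chosen
  name \<open>b\<close> is fresh, so \<open>case_nat b id\<close> is injective on the names of the
  derivatives and the closure contains the opened pair.\<close>

lemma matches_res:
  assumes "matches C R V P Q" and "cl C R P Q"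
  shows "matches C R V (Nu P) (Nu Q)"
  unfolding matches_def
proof (intro allI impI)
  fix \<mu> P' assume V: "\<mu> = TauA \<longrightarrow> V" and bn: "bn \<mu> \<inter> fn (Nu Q) = {}" and st: "step (Nu P) \<mu> P'"
  from st show "\<exists>Q'. wstep_hat (Nu Q) \<mu> Q' \<and> cl C R P' Q'"
  proof (cases rule: step_Nu_cases)
    case (res P0)
    have "bn (act_subst Suc \<mu>) \<inter> fn Q = {}" using bn by auto
    then obtain Q0 where "wstep_hat Q (act_subst Suc \<mu>) Q0" "cl C R P0 Q0"
      using matchesE[OF assms(1) res(1)] V by auto
    then show ?thesis using res wstep_hat_Nu cl_gcl.res by blast
  next
    case op: ("open" a b P0)
    obtain Q0 where Q0: "wstep Q (OutA (Suc a) 0) Q0" "cl C R P0 Q0"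
      using matches_wstepE[OF assms(1) op(3)] by auto
    have b: "b \<notin> fn (Nu Q)" using bn op by auto
    have "fn P0 \<union> fn Q0 \<subseteq> insert (Suc a) (insert 0 (fn P \<union> fn Q))"
      using step_fn[OF op(3)] wstep_fn[OF Q0(1)] by auto
    moreover have "a \<noteq> b" using op step_Out_fn[OF op(3)] by auto
    ultimately have "Suc b \<notin> fn P0 \<union> fn Q0" using b op by auto
    then have "inj_on (case_nat b id) (fn P0 \<union> fn Q0)"
      by (auto simp: inj_on_def split: nat.split)
    then have "cl C R (subst (case_nat b id) P0) (subst (case_nat b id) Q0)"
      using Q0(2) cl_gcl.sub by blast
    then show ?thesis using wstep_Nu_open[OF Q0(1) b] op by (auto simp: wstep_hat_def)
  qed
qed

lemma matches_par:
  assumes "matches C R V P Q" and "cl C R P Q" and "matches C R V P' Q'" and "cl C R P' Q'"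
  shows "matches C R V (Par P P') (Par Q Q')"
  unfolding matches_def
proof (intro allI impI)
  fix \<mu> S assume V: "\<mu> = TauA \<longrightarrow> V" and bn: "bn \<mu> \<inter> fn (Par Q Q') = {}" and st: "step (Par P P') \<mu> S"
  \<comment> \<open>The closing name is taken fresh for the answering processes, so that one of them
    can extrude it and the other receive it without capture.\<close>
  have "finite (fn Q \<union> fn Q')" by simp
  with st show "\<exists>T. wstep_hat (Par Q Q') \<mu> T \<and> cl C R S T"
  proof (cases rule: step_Par_cases)
    case (parL P1)
    then obtain Q1 where Q1: "wstep_hat Q \<mu> Q1" "cl C R P1 Q1"
      using matchesE[OF assms(1) parL(1)] V bn by auto
    have "wstep_hat (Par Q Q') \<mu> (Par Q1 Q')" by (rule wstep_hat_parL[OF Q1(1)]) (use bn in auto)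
    moreover have "cl C R S (Par Q1 Q')" unfolding parL(3) by (rule cl_gcl.par[OF Q1(2) assms(4)])
    ultimately show ?thesis by blast
  next
    case (parR P1)
    then obtain Q1 where Q1: "wstep_hat Q' \<mu> Q1" "cl C R P1 Q1"
      using matchesE[OF assms(3) parR(1)] V bn by auto
    have "wstep_hat (Par Q Q') \<mu> (Par Q Q1)" by (rule wstep_hat_parR[OF Q1(1)]) (use bn in auto)
    moreover have "cl C R S (Par Q Q1)" unfolding parR(3) by (rule cl_gcl.par[OF assms(2) Q1(2)])
    ultimately show ?thesis by blast
  next
    case (commL a b P1 P1')
    obtain Q1 where Q1: "wstep Q (InA a b) Q1" "cl C R P1 Q1"
      using matches_wstepE[OF assms(1) commL(2)] by auto
    obtain Q1' where Q1': "wstep Q' (OutA a b) Q1'" "cl C R P1' Q1'"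
      using matches_wstepE[OF assms(3) commL(3)] by auto
    have "taus (Par Q Q') (Par Q1 Q1')" by (rule wstep_comm(1)[OF Q1(1) Q1'(1)])
    moreover have "cl C R S (Par Q1 Q1')" unfolding commL(4) by (rule cl_gcl.par[OF Q1(2) Q1'(2)])
    ultimately show ?thesis using commL(1) by (auto simp: wstep_hat_def)
  next
    case (commR a b P1 P1')
    obtain Q1 where Q1: "wstep Q (OutA a b) Q1" "cl C R P1 Q1"
      using matches_wstepE[OF assms(1) commR(2)] by auto
    obtain Q1' where Q1': "wstep Q' (InA a b) Q1'" "cl C R P1' Q1'"
      using matches_wstepE[OF assms(3) commR(3)] by auto
    have "taus (Par Q Q') (Par Q1 Q1')" by (rule wstep_comm(2)[OF Q1'(1) Q1(1)])
    moreover have "cl C R S (Par Q1 Q1')" unfolding commR(4) by (rule cl_gcl.par[OF Q1(2) Q1'(2)])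
    ultimately show ?thesis using commR(1) by (auto simp: wstep_hat_def)
  next
    case (closeL a b P1 P1')
    obtain Q1 where Q1: "wstep Q (InA a b) Q1" "cl C R P1 Q1"
      using matches_wstepE[OF assms(1) closeL(2)] by auto
    obtain Q1' where Q1': "wstep Q' (BOutA a b) Q1'" "cl C R P1' Q1'"
      using matches_wstepE[OF assms(3) closeL(3)] closeL by auto
    have "taus (Par Q Q') (nu b (Par Q1 Q1'))"
      by (rule wstep_close(1)[OF Q1(1) Q1'(1)]) (use closeL in simp)
    moreover have "cl C R S (nu b (Par Q1 Q1'))"
      unfolding closeL(6) by (rule cl_nu[OF cl_gcl.par[OF Q1(2) Q1'(2)]])
    ultimately show ?thesis using closeL(1) by (auto simp: wstep_hat_def)
  next
    case (closeR a b P1 P1')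
    obtain Q1 where Q1: "wstep Q (BOutA a b) Q1" "cl C R P1 Q1"
      using matches_wstepE[OF assms(1) closeR(2)] closeR by auto
    obtain Q1' where Q1': "wstep Q' (InA a b) Q1'" "cl C R P1' Q1'"
      using matches_wstepE[OF assms(3) closeR(3)] by auto
    have "taus (Par Q Q') (nu b (Par Q1 Q1'))"
      by (rule wstep_close(2)[OF Q1'(1) Q1(1)]) (use closeR in simp)
    moreover have "cl C R S (nu b (Par Q1 Q1'))"
      unfolding closeR(6) by (rule cl_nu[OF cl_gcl.par[OF Q1(2) Q1'(2)]])
    ultimately show ?thesis using closeR(1) by (auto simp: wstep_hat_def)
  qed
qed

text \<open>A derivation for \<open>Bang G\<close> may unfold it repeatedly, so the argument is an
  inner induction on derivations. No closing arises, because neither \<open>Bang G\<close> nor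
  \<open>Grd G\<close> has bound outputs.\<close>

lemma matches_rep:
  assumes "matches C R V (Grd G) (Grd G')" and "cl C R (Grd G) (Grd G')"
  shows "matches C R V (Bang G) (Bang G')"
proof -
  let ?B = "Par (Bang G') (Grd G')"
  have Bang: "cl C R (Bang G) (Bang G')" using assms(2) by (rule cl_gcl.rep)
  \<comment> \<open>An answer of the unfolding is an answer of \<open>Bang G'\<close>, except for
    the empty one. Then \<open>Bang G'\<close> stays where it is, and the pair is repaired by
    \<open>expansion_Bang\<close>.\<close>
  have fold: "\<exists>Q'. wstep_hat (Bang G') \<mu> Q' \<and> cl C R P' Q'"
    if "\<exists>Q'. wstep_hat ?B \<mu> Q' \<and> cl C R P' Q'" for \<mu> P'
  proof -
    from that obtain Q' where Q': "wstep_hat ?B \<mu> Q'" "cl C R P' Q'" by blast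
    have "cl C R P' (Bang G')" if "Q' = ?B"
      using Q'(2) that expansion_Bang expansion_refl cl_gcl.exp by blast
    moreover have "wstep_hat (Bang G') TauA (Bang G')" by (simp add: wstep_hat_def)
    ultimately show ?thesis using wstep_hat_Bang[OF Q'(1)] Q'(2) by blast
  qed
  \<comment> \<open>\<open>X\<close> ranges over \<open>Bang G\<close> and its unfolding at once,
    since the derivation alternates between the two.\<close>
  have "\<exists>Q'. wstep_hat ?B \<mu> Q' \<and> cl C R P' Q'"
    if "step X \<mu> P'" "\<mu> = TauA \<longrightarrow> V" "X = Bang G \<or> X = Par (Bang G) (Grd G)" for X \<mu> P'
    using that
  proof (induction rule: step.induct)
    case (parL X \<mu> P' Y)
    then have XY: "X = Bang G" "Y = Grd G" by auto
    have "bn \<mu> = {}" using parL(1) guarded_no_BOut(2) XY by (cases \<mu>) auto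
    moreover obtain Q' where Q': "wstep_hat (Bang G') \<mu> Q'" "cl C R P' Q'"
      using fold parL.IH parL.prems XY by blast
    ultimately have "wstep_hat ?B \<mu> (Par Q' (Grd G'))" by (intro wstep_hat_parL) simp_all
    then show ?case using cl_gcl.par[OF Q'(2) assms(2)] XY by blast
  next
    case (parR Y \<mu> P' X)
    then have XY: "X = Bang G" "Y = Grd G" by auto
    have "bn \<mu> = {}" using parR(1) guarded_no_BOut(1) XY by (cases \<mu>) auto
    moreover from this obtain Q' where Q': "wstep_hat (Grd G') \<mu> Q'" "cl C R P' Q'"
      using matchesE[OF assms(1), of \<mu> P'] parR(1) parR.prems XY by auto
    ultimately have "wstep_hat ?B \<mu> (Par (Bang G') Q')" by (intro wstep_hat_parR) simp_all
    then show ?case using cl_gcl.par[OF Bang Q'(2)] XY by blast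
  next
    case (commL X a b P' Y Q')
    then have XY: "X = Bang G" "Y = Grd G" by auto
    obtain S where S: "wstep (Bang G') (InA a b) S" "cl C R P' S"
      using fold[OF commL.IH(1)] XY by (auto simp: wstep_hat_def)
    obtain T where T: "wstep (Grd G') (OutA a b) T" "cl C R Q' T"
      using matches_wstepE[OF assms(1), of "OutA a b" Q'] commL(2) XY by auto
    show ?case using wstep_comm(1)[OF S(1) T(1)] cl_gcl.par[OF S(2) T(2)] by (auto simp: wstep_hat_def)
  next
    case (commR Y a b Q' X P')
    then have XY: "X = Bang G" "Y = Grd G" by auto
    obtain S where S: "wstep (Bang G') (OutA a b) S" "cl C R P' S"
      using fold[OF commR.IH(2)] XY by (auto simp: wstep_hat_def)
    obtain T where T: "wstep (Grd G') (InA a b) T" "cl C R Q' T"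
      using matches_wstepE[OF assms(1), of "InA a b" Q'] commR(1) XY by auto
    show ?case using wstep_comm(2)[OF T(1) S(1)] cl_gcl.par[OF S(2) T(2)] by (auto simp: wstep_hat_def)
  next
    case (closeL X a b P' Y Q')
    then show ?case using guarded_no_BOut(1) by blast
  next
    case (closeR Y a b Q' X P')
    then show ?case using guarded_no_BOut(2) by blast
  qed (auto simp: nu_def)
  then show ?thesis using fold unfolding matches_def by blast
qed

lemma cl_matches_aux:
  assumes "calculus C" and "weak_acp C" and "R \<subseteq> wb {(P, Q). cl C R P Q}"
    and "V \<Longrightarrow> \<forall>P Q. cl C R P Q \<longrightarrow> matches C R False P Q"
    and "cl C R P Q"
  shows "matches C R V P Q"
  using assms(5)
proof (induction rule: cl_gcl.inducts(1)[where ?P2.0 = "\<lambda>_ _. True"])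
  case (base P Q)
  then have "(P, Q) \<in> ws {(P, Q). cl C R P Q}" using assms(3) unfolding wb_def by blast
  then show ?case unfolding matches_def by (blast elim: wsE)
next
  case (conv P Q)
  then have "(Q, P) \<in> ws ({(P, Q). cl C R P Q}\<inverse>)" using assms(3) unfolding wb_def by blast
  then show ?case unfolding matches_def by (blast elim: wsE intro: cl_sym(1))
next
  case (refl P)
  then show ?case unfolding matches_def using wstep_hat_step cl_gcl.refl by blast
next
  case (exp P P1 Q1 Q)
  then show ?case by (blast intro: matches_exp)
next
  case (sub P Q \<sigma>)
  then show ?case using matches_sub[OF assms(1,2)] assms(4) by blast
next
  case (res P Q)
  then show ?case by (blast intro: matches_res)
next
  case (par P Q P' Q')
  then show ?case by (blast intro: matches_par)
next
  case (rep G G')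
  then show ?case by (blast intro: matches_rep)
next
  case (grd G G')
  then show ?case unfolding matches_def using gcl_step wstep_hat_step by blast
qed auto

text \<open>For \<open>V = False\<close> the fourth assumption of \<open>cl_matches_aux\<close>
  holds vacuously; the result of this pass is that assumption for \<open>V = True\<close>.\<close>

lemma cl_matches:
  assumes "calculus C" and "weak_acp C" and "R \<subseteq> wb {(P, Q). cl C R P Q}" and "cl C R P Q"
  shows "matches C R True P Q"
  using assms cl_matches_aux[OF assms(1-3), of False] cl_matches_aux[OF assms(1-3), of True] by blast

section \<open>From the closure to soundness\<close>

lemma wb_mono: "R \<subseteq> S \<Longrightarrow> wb R \<subseteq> wb S"
  unfolding wb_def using ws_mono[of R S] ws_mono[of "R\<inverse>" "S\<inverse>"] by blast

lemma cl_nus: "cl C R P Q \<Longrightarrow> cl C R (nus as P) (nus as Q)"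
  unfolding nus_def by (induction as) (auto intro: cl_nu)

text \<open>Membership in \<open>C\<close> is carried along because it provides the side conditions
  of \<open>sub\<close> and \<open>ginp\<close>: the operators are only applied to pairs inside the
  calculus.\<close>

lemma up_base_cl:
  assumes "S \<subseteq> {(P, Q). cl C R P Q} \<inter> C \<times> C"
  shows "up_base C S \<subseteq> {(P, Q). cl C R P Q} \<inter> C \<times> C"
proof -
  have S: "cl C R P Q \<and> P \<in> C \<and> Q \<in> C" if "(P, Q) \<in> S" for P Q using assms that by auto
  have summand: "gcl C R G G'" if "(Grd G, Grd G') \<in> up_tau S \<union> up_out S \<union> up_inp S \<union> up_refl S" for G G'
    using that S by (auto simp: up_tau_def up_out_def up_inp_def up_refl_def intro: cl_gcl.intros)
  have sum: "\<exists>G G'. P = Grd G \<and> Q = Grd G' \<and> gcl C R G G'" if "(P, Q) \<in> up_sum S" for P Q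
    using that by induction (auto intro: summand cl_gcl.intros)
  have "cl C R P Q" if "(P, Q) \<in> up_exp S \<union> S \<union> up_refl S \<union> up_sub S \<union> up_res S \<union> up_pcomp S \<union> up_sum S
     \<union> up_rep S \<union> up_tau S \<union> up_out S \<union> up_inp S" for P Q
  proof -
    consider "(P, Q) \<in> up_exp S" | "(P, Q) \<in> S \<union> up_refl S \<union> up_sub S" | "(P, Q) \<in> up_res S"
      | "(P, Q) \<in> up_pcomp S \<union> up_rep S" | "(P, Q) \<in> up_sum S" | "(P, Q) \<in> up_tau S \<union> up_out S \<union> up_inp S"
      using \<open>(P, Q) \<in> _\<close> by blast
    then show ?thesis
    proof cases
      case 1
      then show ?thesis using S unfolding up_exp_def by (blast intro: cl_gcl.exp)
    next
      case 2
      then show ?thesis using S unfolding up_refl_def up_sub_def by (auto intro: cl_gcl.refl cl_gcl.sub)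
    next
      case 3
      then show ?thesis using S cl_nus unfolding up_res_def by blast
    next
      case 4
      then show ?thesis using S unfolding up_pcomp_def up_rep_def by (auto intro: cl_gcl.par cl_gcl.rep)
    next
      case 5
      then show ?thesis using sum cl_gcl.grd by blast
    next
      case 6
      then obtain G G' where "P = Grd G" "Q = Grd G'" by (auto simp: up_tau_def up_out_def up_inp_def)
      with 6 show ?thesis using summand cl_gcl.grd by blast
    qed
  qed
  then show ?thesis unfolding up_base_def by auto
qed

lemma omega_up_base_cl:
  assumes "R \<subseteq> C \<times> C"
  shows "omega (up_base C) R \<subseteq> {(P, Q). cl C R P Q}"
proof -
  have "(up_base C ^^ n) R \<subseteq> {(P, Q). cl C R P Q} \<inter> C \<times> C" for n
  proof (induction n)
    case 0
    then show ?case using assms by (auto intro: cl_gcl.base)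
  next
    case (Suc n)
    then show ?case using up_base_cl[OF Suc.IH] by simp
  qed
  then show ?thesis unfolding omega_def by blast
qed

theorem theorem36:
  fixes C :: "proc set"
  assumes "calculus C"
    and "weak_acp C"
  shows "sound_on C wb_bar (omega (up_base C))"
  unfolding sound_on_def
proof (intro exI conjI allI impI)
  \<comment> \<open>The closure has pairs outside \<open>C\<close>, needed for the induction only.
    Cutting it down to \<open>C\<close> at the end is harmless, as derivatives of members of
    \<open>C\<close> stay in \<open>C\<close>.\<close>
  let ?f = "\<lambda>R. {(P, Q). cl C R P Q} \<inter> C \<times> C"
  show "?f R \<subseteq> C \<times> C" for R by blast
  show "extensive_on C ?f" unfolding extensive_on_def by (auto intro: cl_gcl.base)
  fix R assume R: "R \<subseteq> C \<times> C" "R \<subseteq> wb_bar (omega (up_base C) R)"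
  then have "R \<subseteq> wb {(P, Q). cl C R P Q}"
    using wb_mono[OF omega_up_base_cl[OF R(1)]] unfolding wb_bar_def by blast
  then have matches: "cl C R P Q \<Longrightarrow> matches C R True P Q" for P Q
    using cl_matches assms by blast
  have ws: "(P, Q) \<in> ws (?f R)" if PQ: "(P, Q) \<in> ?f R" for P Q
    unfolding ws_def
  proof (intro CollectI case_prodI allI impI)
    fix \<mu> P' assume st: "bn \<mu> \<inter> fn Q = {}" "step P \<mu> P'"
    then obtain Q' where "wstep_hat Q \<mu> Q'" "cl C R P' Q'"
      using matchesE[OF matches] PQ by blast
    then show "\<exists>Q'. wstep_hat Q \<mu> Q' \<and> (P', Q') \<in> ?f R"
      using PQ st step_in_calculus wstep_hat_in_calculus assms(1) by blast
  qed
  have "(?f R)\<inverse> = ?f R" using cl_sym(1) by blast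
  then show "?f R \<subseteq> wb_bar (?f R)" using ws unfolding wb_bar_def wb_def by auto
qed

end
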